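(* Let $n$ be a positive integer such that either $n$ is odd, or $n = 2^k$ for some positive integer $k$, or $n = 6$, or $n = 10$. Let $R = \begin{pmatrix} A & M \\ N & B \end{pmatrix}$ be a Morita context ring such that $MN$ and $NM$ are nilpotent ideals of $A$ and $B$, respectively. Then $R$ is $n$-UU if and only if both $A$ and $B$ are $n$-UU rings.
   Context: Rings are associative with identity, not necessarily commutative. For a positive integer $n$, a ring $R$ is $n$-UU if $u^n - 1$ is nilpotent for every unit $u$ of $R$. Morita context ring: let $A, B$ be rings, $M$ an $(A,B)$-bimodule, $N$ a $(B,A)$-bimodule, and $\phi : M \otimes_B N \to A$, $\psi : N \otimes_A M \to B$ bimodule homomorphisms such that $\mathrm{Id}_M \otimes_B \psi = \phi \otimes_A \mathrm{Id}_M$ and $\mathrm{Id}_N \otimes_A \phi = \psi \otimes_B \mathrm{Id}_N$ (after the usual identifications). Write $mn := \phi(m\otimes n)$ and $nm := \psi(n \otimes m)$ for $m\in M$, $n \in N$. Then the set of matrices $\begin{pmatrix} a & m \\ n & b\end{pmatrix}$ with $a\in A$, $m \in M$, $n\in N$, $b \in B$ is an associative ring under the obvious matrix operations, called a Morita context ring. The ideals $MN := \mathrm{Im}\,\phi$ of $A$ and $NM := \mathrm{Im}\,\psi$ of $B$ are its trace ideals. *)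

theory Defs
  imports "HOL-Algebra.Algebra"
begin

definition nilpotent :: "('a, 'x) ring_scheme \<Rightarrow> 'a \<Rightarrow> bool" where
  "nilpotent R x \<longleftrightarrow> (\<exists>k::nat. x [^]\<^bsub>R\<^esub> k = \<zero>\<^bsub>R\<^esub>)"

definition n_UU :: "nat \<Rightarrow> ('a, 'x) ring_scheme \<Rightarrow> bool" where
  "n_UU n R \<longleftrightarrow> (\<forall>u\<in>Units R. nilpotent R (u [^]\<^bsub>R\<^esub> n \<ominus>\<^bsub>R\<^esub> \<one>\<^bsub>R\<^esub>))"

primrec ideal_pow :: "('a, 'x) ring_scheme \<Rightarrow> 'a set \<Rightarrow> nat \<Rightarrow> 'a set" where
  "ideal_pow R I 0 = carrier R"
| "ideal_pow R I (Suc k) = ideal_prod R (ideal_pow R I k) I"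

text \<open>In the definitions of nilpotency the exponent 0 is harmless: it can only occur in the zero
  ring, where the exponent 1 works as well.\<close>

definition nilpotent_ideal :: "'a set \<Rightarrow> ('a, 'x) ring_scheme \<Rightarrow> bool" where
  "nilpotent_ideal I R \<longleftrightarrow> ideal I R \<and> (\<exists>k. ideal_pow R I k = {\<zero>\<^bsub>R\<^esub>})"


section \<open>Bimodules over not necessarily commutative rings\<close>

text \<open>As for the record \<^type>\<open>module\<close>, the fields \<^const>\<open>monoid.mult\<close> and \<^const>\<open>one\<close> of a
  bimodule are junk. The left action is the library's \<^const>\<open>smult\<close>.\<close>

record ('a, 'b, 'm) bimodule = "('a, 'm) module" +
  rsmult :: "'m \<Rightarrow> 'b \<Rightarrow> 'm" (infixl \<open>\<triangleleft>\<index>\<close> 70)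

locale bimodule = A: ring A + B: ring B + M: abelian_group M
  for A :: "('a, 'x) ring_scheme" and B :: "('b, 'y) ring_scheme"
    and M :: "('a, 'b, 'm) bimodule" +
  assumes l_closed: "\<lbrakk>a \<in> carrier A; m \<in> carrier M\<rbrakk> \<Longrightarrow> a \<odot>\<^bsub>M\<^esub> m \<in> carrier M"
    and l_distr_ring: "\<lbrakk>a \<in> carrier A; a' \<in> carrier A; m \<in> carrier M\<rbrakk>
      \<Longrightarrow> (a \<oplus>\<^bsub>A\<^esub> a') \<odot>\<^bsub>M\<^esub> m = a \<odot>\<^bsub>M\<^esub> m \<oplus>\<^bsub>M\<^esub> a' \<odot>\<^bsub>M\<^esub> m"
    and l_distr: "\<lbrakk>a \<in> carrier A; m \<in> carrier M; m' \<in> carrier M\<rbrakk>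
      \<Longrightarrow> a \<odot>\<^bsub>M\<^esub> (m \<oplus>\<^bsub>M\<^esub> m') = a \<odot>\<^bsub>M\<^esub> m \<oplus>\<^bsub>M\<^esub> a \<odot>\<^bsub>M\<^esub> m'"
    and l_assoc: "\<lbrakk>a \<in> carrier A; a' \<in> carrier A; m \<in> carrier M\<rbrakk>
      \<Longrightarrow> (a \<otimes>\<^bsub>A\<^esub> a') \<odot>\<^bsub>M\<^esub> m = a \<odot>\<^bsub>M\<^esub> (a' \<odot>\<^bsub>M\<^esub> m)"
    and l_one: "m \<in> carrier M \<Longrightarrow> \<one>\<^bsub>A\<^esub> \<odot>\<^bsub>M\<^esub> m = m"
    and r_closed: "\<lbrakk>m \<in> carrier M; b \<in> carrier B\<rbrakk> \<Longrightarrow> m \<triangleleft>\<^bsub>M\<^esub> b \<in> carrier M"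
    and r_distr_ring: "\<lbrakk>b \<in> carrier B; b' \<in> carrier B; m \<in> carrier M\<rbrakk>
      \<Longrightarrow> m \<triangleleft>\<^bsub>M\<^esub> (b \<oplus>\<^bsub>B\<^esub> b') = m \<triangleleft>\<^bsub>M\<^esub> b \<oplus>\<^bsub>M\<^esub> m \<triangleleft>\<^bsub>M\<^esub> b'"
    and r_distr: "\<lbrakk>b \<in> carrier B; m \<in> carrier M; m' \<in> carrier M\<rbrakk>
      \<Longrightarrow> (m \<oplus>\<^bsub>M\<^esub> m') \<triangleleft>\<^bsub>M\<^esub> b = m \<triangleleft>\<^bsub>M\<^esub> b \<oplus>\<^bsub>M\<^esub> m' \<triangleleft>\<^bsub>M\<^esub> b"
    and r_assoc: "\<lbrakk>b \<in> carrier B; b' \<in> carrier B; m \<in> carrier M\<rbrakk>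
      \<Longrightarrow> m \<triangleleft>\<^bsub>M\<^esub> (b \<otimes>\<^bsub>B\<^esub> b') = (m \<triangleleft>\<^bsub>M\<^esub> b) \<triangleleft>\<^bsub>M\<^esub> b'"
    and r_one: "m \<in> carrier M \<Longrightarrow> m \<triangleleft>\<^bsub>M\<^esub> \<one>\<^bsub>B\<^esub> = m"
    and lr_assoc: "\<lbrakk>a \<in> carrier A; m \<in> carrier M; b \<in> carrier B\<rbrakk>
      \<Longrightarrow> (a \<odot>\<^bsub>M\<^esub> m) \<triangleleft>\<^bsub>M\<^esub> b = a \<odot>\<^bsub>M\<^esub> (m \<triangleleft>\<^bsub>M\<^esub> b)"

definition regular_bimodule :: "('a, 'x) ring_scheme \<Rightarrow> ('a, 'a, 'a) bimodule" where
  "regular_bimodule A =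
    \<lparr>carrier = carrier A, monoid.mult = monoid.mult A, monoid.one = \<one>\<^bsub>A\<^esub>,
     ring.zero = \<zero>\<^bsub>A\<^esub>, ring.add = add A,
     smult = monoid.mult A, rsmult = monoid.mult A\<rparr>"

definition bimodule_hom :: "('a, 'x) ring_scheme \<Rightarrow> ('b, 'y) ring_scheme \<Rightarrow>
    ('a, 'b, 'm) bimodule \<Rightarrow> ('a, 'b, 'k) bimodule \<Rightarrow> ('m \<Rightarrow> 'k) set" where
  "bimodule_hom A B U V = {f \<in> hom (add_monoid U) (add_monoid V).
     (\<forall>a\<in>carrier A. \<forall>x\<in>carrier U. f (a \<odot>\<^bsub>U\<^esub> x) = a \<odot>\<^bsub>V\<^esub> f x) \<and>
     (\<forall>b\<in>carrier B. \<forall>x\<in>carrier U. f (x \<triangleleft>\<^bsub>U\<^esub> b) = f x \<triangleleft>\<^bsub>V\<^esub> b)}"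


section \<open>Tensor products\<close>

text \<open>The tensor product over \<open>B\<close> is the free abelian group on the pairs, modulo the subgroup
  generated by the biadditivity and balancing relators.\<close>

definition tensor_relators :: "('b, 'y) ring_scheme \<Rightarrow> ('a, 'b, 'm) bimodule \<Rightarrow>
    ('b, 'c, 'n) bimodule \<Rightarrow> ('m \<times> 'n \<Rightarrow>\<^sub>0 int) set" where
  "tensor_relators B M N =
     {frag_of (m \<oplus>\<^bsub>M\<^esub> m', n) - frag_of (m, n) - frag_of (m', n) | m m' n.
        m \<in> carrier M \<and> m' \<in> carrier M \<and> n \<in> carrier N} \<union>
     {frag_of (m, n \<oplus>\<^bsub>N\<^esub> n') - frag_of (m, n) - frag_of (m, n') | m n n'.
        m \<in> carrier M \<and> n \<in> carrier N \<and> n' \<in> carrier N} \<union>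
     {frag_of (m \<triangleleft>\<^bsub>M\<^esub> b, n) - frag_of (m, b \<odot>\<^bsub>N\<^esub> n) | m b n.
        m \<in> carrier M \<and> b \<in> carrier B \<and> n \<in> carrier N}"

abbreviation tensor_free :: "('a, 'b, 'm) bimodule \<Rightarrow> ('b, 'c, 'n) bimodule \<Rightarrow>
    ('m \<times> 'n \<Rightarrow>\<^sub>0 int) monoid" where
  "tensor_free M N \<equiv> free_Abelian_group (carrier M \<times> carrier N)"

definition tensor_kernel :: "('b, 'y) ring_scheme \<Rightarrow> ('a, 'b, 'm) bimodule \<Rightarrow>
    ('b, 'c, 'n) bimodule \<Rightarrow> ('m \<times> 'n \<Rightarrow>\<^sub>0 int) set" where
  "tensor_kernel B M N = generate (tensor_free M N) (tensor_relators B M N)"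

text \<open>The map of cosets induced by a map \<open>h\<close> on pairs; adding the kernel to the image of a
  coset completes that image to a full coset (see \<open>tensor_act_coset\<close> below).\<close>

definition tensor_act :: "('b, 'y) ring_scheme \<Rightarrow> ('a, 'b, 'm) bimodule \<Rightarrow>
    ('b, 'c, 'n) bimodule \<Rightarrow> ('m \<times> 'n \<Rightarrow> 'm \<times> 'n) \<Rightarrow>
    ('m \<times> 'n \<Rightarrow>\<^sub>0 int) set \<Rightarrow> ('m \<times> 'n \<Rightarrow>\<^sub>0 int) set" where
  "tensor_act B M N h T =
     tensor_kernel B M N <#>\<^bsub>tensor_free M N\<^esub> (frag_extend (frag_of \<circ> h) ` T)"

definition tensor_product :: "('b, 'y) ring_scheme \<Rightarrow> ('a, 'b, 'm) bimodule \<Rightarrow>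
    ('b, 'c, 'n) bimodule \<Rightarrow> ('a, 'c, ('m \<times> 'n \<Rightarrow>\<^sub>0 int) set) bimodule" where
  "tensor_product B M N =
    \<lparr>carrier = carrier (tensor_free M N Mod tensor_kernel B M N),
     monoid.mult = undefined, monoid.one = undefined,
     ring.zero = \<one>\<^bsub>tensor_free M N Mod tensor_kernel B M N\<^esub>,
     ring.add = monoid.mult (tensor_free M N Mod tensor_kernel B M N),
     smult = (\<lambda>a. tensor_act B M N (\<lambda>(m, n). (a \<odot>\<^bsub>M\<^esub> m, n))),
     rsmult = (\<lambda>T c. tensor_act B M N (\<lambda>(m, n). (m, n \<triangleleft>\<^bsub>N\<^esub> c)) T)\<rparr>"

definition pure_tensor :: "('b, 'y) ring_scheme \<Rightarrow> ('a, 'b, 'm) bimodule \<Rightarrow>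
    ('b, 'c, 'n) bimodule \<Rightarrow> 'm \<Rightarrow> 'n \<Rightarrow> ('m \<times> 'n \<Rightarrow>\<^sub>0 int) set" where
  "pure_tensor B M N m n = tensor_kernel B M N #>\<^bsub>tensor_free M N\<^esub> frag_of (m, n)"


context
  fixes A :: "('a, 'x) ring_scheme" and B :: "('b, 'y) ring_scheme" and C :: "('c, 'z) ring_scheme"
    and M :: "('a, 'b, 'm) bimodule" and N :: "('b, 'c, 'n) bimodule"
  assumes M: "bimodule A B M" and N: "bimodule B C N"
begin

interpretation M: bimodule A B M by (rule M)
interpretation N: bimodule B C N by (rule N)

lemma tensor_relators_subset: "tensor_relators B M N \<subseteq> carrier (tensor_free M N)"
proof
  fix r assume "r \<in> tensor_relators B M N"
  moreover have k: "x - y \<in> carrier (tensor_free M N)"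
    if "x \<in> carrier (tensor_free M N)" "y \<in> carrier (tensor_free M N)" for x y
    using that unfolding carrier_free_Abelian_group_iff
    by (intro order.trans[OF keys_diff] Un_least)
  have g: "frag_of (m, n) \<in> carrier (tensor_free M N)" if "m \<in> carrier M" "n \<in> carrier N" for m n
    using that by simp
  ultimately show "r \<in> carrier (tensor_free M N)"
    unfolding tensor_relators_def
    by (elim UnE CollectE exE conjE; hypsubst)
      (intro k g M.M.a_closed N.M.a_closed M.r_closed N.l_closed; assumption)+
qed

lemma tensor_kernel_subgroup: "subgroup (tensor_kernel B M N) (tensor_free M N)"
  unfolding tensor_kernel_def
  by (rule group.generate_is_subgroup[OF group_free_Abelian_group tensor_relators_subset])

lemma tensor_kernel_normal: "tensor_kernel B M N \<lhd> tensor_free M N"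
  using comm_group.normal_iff_subgroup[OF abelian_free_Abelian_group] tensor_kernel_subgroup by blast

lemma tensor_comm_group: "comm_group (tensor_free M N Mod tensor_kernel B M N)"
  by (rule comm_group.abelian_FactGroup[OF abelian_free_Abelian_group tensor_kernel_subgroup])

lemma tensor_abelian_group: "abelian_group (tensor_product B M N)"
proof -
  let ?Q = "tensor_free M N Mod tensor_kernel B M N"
  interpret Q: comm_group ?Q by (rule tensor_comm_group)
  have eqs: "carrier (tensor_product B M N) = carrier ?Q" "add (tensor_product B M N) = monoid.mult ?Q"
    "\<zero>\<^bsub>tensor_product B M N\<^esub> = \<one>\<^bsub>?Q\<^esub>"
    by (simp_all add: tensor_product_def)
  show ?thesis
    by (rule abelian_groupI; unfold eqs)
      (rule Q.m_closed Q.one_closed Q.m_assoc Q.m_comm Q.l_one Q.l_inv_ex; assumption)+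
qed

lemma tensor_kernel_0: "0 \<in> tensor_kernel B M N"
  using subgroup.one_closed[OF tensor_kernel_subgroup] by simp

lemma tensor_kernel_add:
  "x \<in> tensor_kernel B M N \<Longrightarrow> y \<in> tensor_kernel B M N \<Longrightarrow> x + y \<in> tensor_kernel B M N"
  using subgroup.m_closed[OF tensor_kernel_subgroup] by simp

lemma tensor_kernel_keys: "x \<in> tensor_kernel B M N \<Longrightarrow> Poly_Mapping.keys x \<subseteq> carrier M \<times> carrier N"
  using subsetD[OF subgroup.subset[OF tensor_kernel_subgroup], of x] by simp

lemma tensor_kernel_uminus: "x \<in> tensor_kernel B M N \<Longrightarrow> - x \<in> tensor_kernel B M N"
  using subgroup.m_inv_closed[OF tensor_kernel_subgroup, of x] tensor_kernel_keys[of x] by simp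

lemma tensor_kernel_extend:
  assumes "\<And>r. r \<in> tensor_relators B M N \<Longrightarrow> frag_extend f r \<in> tensor_kernel B M N"
    and "x \<in> tensor_kernel B M N"
  shows "frag_extend f x \<in> tensor_kernel B M N"
  using assms(2) unfolding tensor_kernel_def
proof (induction x rule: generate.induct)
  case one
  then show ?case using tensor_kernel_0 by (simp add: tensor_kernel_def)
next
  case (incl r)
  then show ?case using assms(1) by (simp add: tensor_kernel_def)
next
  case (inv r)
  then have "Poly_Mapping.keys r \<subseteq> carrier M \<times> carrier N" using subsetD[OF tensor_relators_subset, of r] by simp
  then show ?case
    using tensor_kernel_uminus[OF assms(1)[OF inv]]
    by (simp add: tensor_kernel_def frag_extend_minus)
next
  case (eng x y)
  then show ?case
    using tensor_kernel_add by (simp add: tensor_kernel_def frag_extend_add)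
qed

lemma tensor_act_coset:
  assumes rel: "\<And>r. r \<in> tensor_relators B M N \<Longrightarrow> frag_extend (frag_of \<circ> h) r \<in> tensor_kernel B M N"
  shows "tensor_act B M N h (tensor_kernel B M N #>\<^bsub>tensor_free M N\<^esub> x) =
    tensor_kernel B M N #>\<^bsub>tensor_free M N\<^esub> frag_extend (frag_of \<circ> h) x"
proof -
  let ?K = "tensor_kernel B M N" and ?f = "frag_extend (frag_of \<circ> h)"
  have f: "?f k \<in> ?K" if "k \<in> ?K" for k
    using tensor_kernel_extend[OF rel that] by simp
  show ?thesis
  proof (intro Set.set_eqI iffI)
    fix y assume "y \<in> tensor_act B M N h (?K #>\<^bsub>tensor_free M N\<^esub> x)"
    then obtain k k' where "k \<in> ?K" "k' \<in> ?K" "y = k + ?f (k' + x)"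
      by (auto simp: tensor_act_def set_mult_def r_coset_def)
    then have "y = (k + ?f k') + ?f x" "k + ?f k' \<in> ?K"
      using f tensor_kernel_add by (auto simp: frag_extend_add add.assoc)
    then show "y \<in> ?K #>\<^bsub>tensor_free M N\<^esub> ?f x"
      by (auto simp: r_coset_def)
  next
    fix y assume "y \<in> ?K #>\<^bsub>tensor_free M N\<^esub> ?f x"
    then obtain k where "k \<in> ?K" "y = k + ?f (0 + x)"
      by (auto simp: r_coset_def)
    then show "y \<in> tensor_act B M N h (?K #>\<^bsub>tensor_free M N\<^esub> x)"
      using tensor_kernel_0 by (force simp: tensor_act_def set_mult_def r_coset_def)
  qed
qed

lemma tensor_relators_kernel: "tensor_relators B M N \<subseteq> tensor_kernel B M N"
  unfolding tensor_kernel_def by (auto intro: generate.incl)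

lemma tensor_relatorsI:
  "\<lbrakk>m \<in> carrier M; m' \<in> carrier M; n \<in> carrier N\<rbrakk>
    \<Longrightarrow> frag_of (m \<oplus>\<^bsub>M\<^esub> m', n) - frag_of (m, n) - frag_of (m', n) \<in> tensor_relators B M N"
  "\<lbrakk>m \<in> carrier M; n \<in> carrier N; n' \<in> carrier N\<rbrakk>
    \<Longrightarrow> frag_of (m, n \<oplus>\<^bsub>N\<^esub> n') - frag_of (m, n) - frag_of (m, n') \<in> tensor_relators B M N"
  "\<lbrakk>m \<in> carrier M; b \<in> carrier B; n \<in> carrier N\<rbrakk>
    \<Longrightarrow> frag_of (m \<triangleleft>\<^bsub>M\<^esub> b, n) - frag_of (m, b \<odot>\<^bsub>N\<^esub> n) \<in> tensor_relators B M N"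
  unfolding tensor_relators_def by blast+

lemma tensor_relatorsE:
  assumes "r \<in> tensor_relators B M N"
  obtains (add_left) m m' n where "m \<in> carrier M" "m' \<in> carrier M" "n \<in> carrier N"
      "r = frag_of (m \<oplus>\<^bsub>M\<^esub> m', n) - frag_of (m, n) - frag_of (m', n)"
    | (add_right) m n n' where "m \<in> carrier M" "n \<in> carrier N" "n' \<in> carrier N"
      "r = frag_of (m, n \<oplus>\<^bsub>N\<^esub> n') - frag_of (m, n) - frag_of (m, n')"
    | (balanced) m b n where "m \<in> carrier M" "b \<in> carrier B" "n \<in> carrier N"
      "r = frag_of (m \<triangleleft>\<^bsub>M\<^esub> b, n) - frag_of (m, b \<odot>\<^bsub>N\<^esub> n)"
  using assms unfolding tensor_relators_def
  by (elim UnE CollectE exE conjE) (rule that; assumption)+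

lemma tensor_relators_left:
  assumes "a \<in> carrier A" "r \<in> tensor_relators B M N"
  shows "frag_extend (frag_of \<circ> (\<lambda>(m, n). (a \<odot>\<^bsub>M\<^esub> m, n))) r \<in> tensor_kernel B M N"
  using assms(2)
proof (cases rule: tensor_relatorsE)
  case (add_left m m' n)
  note * = tensor_relatorsI(1)[of "a \<odot>\<^bsub>M\<^esub> m" "a \<odot>\<^bsub>M\<^esub> m'" n]
  show ?thesis
    unfolding add_left(4)
    by (rule subsetD[OF tensor_relators_kernel])
      (use * add_left(1-3) assms(1) in \<open>simp only: frag_extend_diff M.l_distr frag_extend_of o_apply case_prod_conv M.l_closed\<close>)
next
  case (add_right m n n')
  note * = tensor_relatorsI(2)[of "a \<odot>\<^bsub>M\<^esub> m" n n']
  show ?thesis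
    unfolding add_right(4)
    by (rule subsetD[OF tensor_relators_kernel])
      (use * add_right(1-3) assms(1) in \<open>simp only: frag_extend_diff frag_extend_of o_apply case_prod_conv M.l_closed\<close>)
next
  case (balanced m b n)
  note * = tensor_relatorsI(3)[of "a \<odot>\<^bsub>M\<^esub> m" b n]
  show ?thesis
    unfolding balanced(4)
    by (rule subsetD[OF tensor_relators_kernel])
      (use * balanced(1-3) assms(1) in \<open>simp only: frag_extend_diff M.lr_assoc frag_extend_of o_apply case_prod_conv M.l_closed\<close>)
qed

lemma tensor_relators_right:
  assumes "c \<in> carrier C" "r \<in> tensor_relators B M N"
  shows "frag_extend (frag_of \<circ> (\<lambda>(m, n). (m, n \<triangleleft>\<^bsub>N\<^esub> c))) r \<in> tensor_kernel B M N"
  using assms(2)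
proof (cases rule: tensor_relatorsE)
  case (add_left m m' n)
  note * = tensor_relatorsI(1)[of m m' "n \<triangleleft>\<^bsub>N\<^esub> c"]
  show ?thesis
    unfolding add_left(4)
    by (rule subsetD[OF tensor_relators_kernel])
      (use * add_left(1-3) assms(1) in \<open>simp only: frag_extend_diff frag_extend_of o_apply case_prod_conv N.r_closed\<close>)
next
  case (add_right m n n')
  note * = tensor_relatorsI(2)[of m "n \<triangleleft>\<^bsub>N\<^esub> c" "n' \<triangleleft>\<^bsub>N\<^esub> c"]
  show ?thesis
    unfolding add_right(4)
    by (rule subsetD[OF tensor_relators_kernel])
      (use * add_right(1-3) assms(1) in \<open>simp only: frag_extend_diff N.r_distr frag_extend_of o_apply case_prod_conv N.r_closed\<close>)
next
  case (balanced m b n)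
  note * = tensor_relatorsI(3)[of m b "n \<triangleleft>\<^bsub>N\<^esub> c"]
  show ?thesis
    unfolding balanced(4)
    by (rule subsetD[OF tensor_relators_kernel])
      (use * balanced(1-3) assms(1) in \<open>simp only: frag_extend_diff N.lr_assoc frag_extend_of o_apply case_prod_conv N.r_closed\<close>)
qed

lemma tensor_smult_coset:
  assumes "a \<in> carrier A"
  shows "a \<odot>\<^bsub>tensor_product B M N\<^esub> (tensor_kernel B M N #>\<^bsub>tensor_free M N\<^esub> x) =
    tensor_kernel B M N #>\<^bsub>tensor_free M N\<^esub> frag_extend (frag_of \<circ> (\<lambda>(m, n). (a \<odot>\<^bsub>M\<^esub> m, n))) x"
  using tensor_act_coset[of "\<lambda>(m, n). (a \<odot>\<^bsub>M\<^esub> m, n)" x] tensor_relators_left[OF assms]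
  by (simp add: tensor_product_def)

lemma tensor_rsmult_coset:
  assumes "c \<in> carrier C"
  shows "(tensor_kernel B M N #>\<^bsub>tensor_free M N\<^esub> x) \<triangleleft>\<^bsub>tensor_product B M N\<^esub> c =
    tensor_kernel B M N #>\<^bsub>tensor_free M N\<^esub> frag_extend (frag_of \<circ> (\<lambda>(m, n). (m, n \<triangleleft>\<^bsub>N\<^esub> c))) x"
  using tensor_act_coset[of "\<lambda>(m, n). (m, n \<triangleleft>\<^bsub>N\<^esub> c)" x] tensor_relators_right[OF assms]
  by (simp add: tensor_product_def)

lemma pure_tensor_closed:
  "m \<in> carrier M \<Longrightarrow> n \<in> carrier N \<Longrightarrow> pure_tensor B M N m n \<in> carrier (tensor_product B M N)"
  by (simp add: pure_tensor_def tensor_product_def carrier_FactGroup)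

lemma pure_tensor_smult:
  "a \<in> carrier A \<Longrightarrow> a \<odot>\<^bsub>tensor_product B M N\<^esub> pure_tensor B M N m n = pure_tensor B M N (a \<odot>\<^bsub>M\<^esub> m) n"
  using tensor_smult_coset[of a "frag_of (m, n)"] by (simp add: pure_tensor_def)

lemma pure_tensor_rsmult:
  "c \<in> carrier C \<Longrightarrow> pure_tensor B M N m n \<triangleleft>\<^bsub>tensor_product B M N\<^esub> c = pure_tensor B M N m (n \<triangleleft>\<^bsub>N\<^esub> c)"
  using tensor_rsmult_coset[of c "frag_of (m, n)"] by (simp add: pure_tensor_def)

lemma tensor_add_coset:
  assumes "Poly_Mapping.keys x \<subseteq> carrier M \<times> carrier N" "Poly_Mapping.keys y \<subseteq> carrier M \<times> carrier N"
  shows "(tensor_kernel B M N #>\<^bsub>tensor_free M N\<^esub> x) \<oplus>\<^bsub>tensor_product B M N\<^esub>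
      (tensor_kernel B M N #>\<^bsub>tensor_free M N\<^esub> y) = tensor_kernel B M N #>\<^bsub>tensor_free M N\<^esub> (x + y)"
  using normal.rcos_sum[OF tensor_kernel_normal, of x y] assms by (simp add: tensor_product_def)

lemma tensor_coset_eqI:
  assumes "Poly_Mapping.keys x \<subseteq> carrier M \<times> carrier N" "Poly_Mapping.keys y \<subseteq> carrier M \<times> carrier N" "x - y \<in> tensor_kernel B M N"
  shows "tensor_kernel B M N #>\<^bsub>tensor_free M N\<^esub> x = tensor_kernel B M N #>\<^bsub>tensor_free M N\<^esub> y"
proof -
  have "x \<in> tensor_kernel B M N #>\<^bsub>tensor_free M N\<^esub> y"
    using assms(3) unfolding r_coset_def by (intro UN_I[of "x - y"]) simp_all
  then show ?thesis
    using group.repr_independence[OF group_free_Abelian_group _ _ tensor_kernel_subgroup, of x y] assms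
    by simp
qed

lemma pure_tensor_add_left:
  assumes "m \<in> carrier M" "m' \<in> carrier M" "n \<in> carrier N"
  shows "pure_tensor B M N (m \<oplus>\<^bsub>M\<^esub> m') n =
    pure_tensor B M N m n \<oplus>\<^bsub>tensor_product B M N\<^esub> pure_tensor B M N m' n"
proof -
  have "frag_of (m \<oplus>\<^bsub>M\<^esub> m', n) - (frag_of (m, n) + frag_of (m', n)) \<in> tensor_kernel B M N"
    by (rule subsetD[OF tensor_relators_kernel])
      (use assms in \<open>auto simp: tensor_relators_def diff_diff_eq\<close>)
  then show ?thesis
    unfolding pure_tensor_def
    by (subst tensor_add_coset) (simp_all add: assms order.trans[OF keys_add] tensor_coset_eqI)
qed

lemma pure_tensor_add_right:
  assumes "m \<in> carrier M" "n \<in> carrier N" "n' \<in> carrier N"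
  shows "pure_tensor B M N m (n \<oplus>\<^bsub>N\<^esub> n') =
    pure_tensor B M N m n \<oplus>\<^bsub>tensor_product B M N\<^esub> pure_tensor B M N m n'"
proof -
  have "frag_of (m, n \<oplus>\<^bsub>N\<^esub> n') - (frag_of (m, n) + frag_of (m, n')) \<in> tensor_kernel B M N"
    by (rule subsetD[OF tensor_relators_kernel])
      (use assms in \<open>auto simp: tensor_relators_def diff_diff_eq\<close>)
  then show ?thesis
    unfolding pure_tensor_def
    by (subst tensor_add_coset) (simp_all add: assms order.trans[OF keys_add] tensor_coset_eqI)
qed

lemma pure_tensor_balanced:
  assumes "m \<in> carrier M" "b \<in> carrier B" "n \<in> carrier N"
  shows "pure_tensor B M N (m \<triangleleft>\<^bsub>M\<^esub> b) n = pure_tensor B M N m (b \<odot>\<^bsub>N\<^esub> n)"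
proof -
  have "frag_of (m \<triangleleft>\<^bsub>M\<^esub> b, n) - frag_of (m, b \<odot>\<^bsub>N\<^esub> n) \<in> tensor_kernel B M N"
    by (rule subsetD[OF tensor_relators_kernel]) (use assms in \<open>auto simp: tensor_relators_def\<close>)
  then show ?thesis
    unfolding pure_tensor_def
    by (rule tensor_coset_eqI[rotated 2]) (simp_all add: assms M.r_closed N.l_closed)
qed

lemma tensor_induct [consumes 1, case_names pure zero diff]:
  assumes T: "T \<in> carrier (tensor_product B M N)"
    and pure: "\<And>m n. m \<in> carrier M \<Longrightarrow> n \<in> carrier N \<Longrightarrow> P (pure_tensor B M N m n)"
    and zero: "P \<zero>\<^bsub>tensor_product B M N\<^esub>"
    and diff: "\<And>s t. s \<in> carrier (tensor_product B M N) \<Longrightarrow> t \<in> carrier (tensor_product B M N) \<Longrightarrow>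
      P s \<Longrightarrow> P t \<Longrightarrow> P (s \<ominus>\<^bsub>tensor_product B M N\<^esub> t)"
  shows "P T"
proof -
  interpret T: abelian_group "tensor_product B M N" by (rule tensor_abelian_group)
  let ?q = "\<lambda>x. tensor_kernel B M N #>\<^bsub>tensor_free M N\<^esub> x"
  have q: "?q x \<in> carrier (tensor_product B M N)" if "Poly_Mapping.keys x \<subseteq> carrier M \<times> carrier N" for x
    using that by (simp add: tensor_product_def carrier_FactGroup)
  obtain x where x: "Poly_Mapping.keys x \<subseteq> carrier M \<times> carrier N" and T: "T = ?q x"
    using T by (auto simp: tensor_product_def carrier_FactGroup)
  from x have "P (?q x)"
  proof (induction x rule: free_Abelian_group_induct[consumes 1])
    case 1
    have "?q 0 = \<zero>\<^bsub>tensor_product B M N\<^esub>"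
      by (simp add: tensor_product_def r_coset_def)
    then show ?case using zero by simp
  next
    case (2 x y)
    have k: "Poly_Mapping.keys (x - y) \<subseteq> carrier M \<times> carrier N"
      using 2(1,2) by (intro order.trans[OF keys_diff] Un_least)
    have "?q (x - y) \<oplus>\<^bsub>tensor_product B M N\<^esub> ?q y = ?q x"
      using tensor_add_coset[OF k 2(2)] by simp
    then have "?q (x - y) = ?q x \<ominus>\<^bsub>tensor_product B M N\<^esub> ?q y"
      using q[OF k] q[OF 2(1)] q[OF 2(2)]
      by (metis T.minus_eq T.add.inv_solve_right)
    then show ?case using diff[OF q[OF 2(1)] q[OF 2(2)] 2(3,4)] by simp
  next
    case (3 p)
    then show ?case using pure[of "fst p" "snd p"] by (auto simp: pure_tensor_def)
  qed
  then show ?thesis using T by simp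
qed

lemma tensor_carrierE:
  assumes "T \<in> carrier (tensor_product B M N)"
  obtains x where "Poly_Mapping.keys x \<subseteq> carrier M \<times> carrier N"
    "T = tensor_kernel B M N #>\<^bsub>tensor_free M N\<^esub> x"
  using assms by (auto simp: tensor_product_def carrier_FactGroup)

lemma tensor_coset_closed:
  "Poly_Mapping.keys x \<subseteq> carrier M \<times> carrier N
    \<Longrightarrow> tensor_kernel B M N #>\<^bsub>tensor_free M N\<^esub> x \<in> carrier (tensor_product B M N)"
  by (simp add: tensor_product_def carrier_FactGroup)

lemma keys_frag_extend_frag_of:
  assumes "Poly_Mapping.keys x \<subseteq> S" "\<And>p. p \<in> S \<Longrightarrow> h p \<in> S'"
  shows "Poly_Mapping.keys (frag_extend (frag_of \<circ> h) x) \<subseteq> S'"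
  using keys_frag_extend[of "frag_of \<circ> h" x] assms by fastforce

lemma tensor_smult_hom:
  assumes "a \<in> carrier A"
  shows "(\<lambda>t. a \<odot>\<^bsub>tensor_product B M N\<^esub> t) \<in>
    hom (add_monoid (tensor_product B M N)) (add_monoid (tensor_product B M N))"
proof -
  let ?f = "frag_extend (frag_of \<circ> (\<lambda>(m, n). (a \<odot>\<^bsub>M\<^esub> m, n)))"
  have k: "Poly_Mapping.keys (?f x) \<subseteq> carrier M \<times> carrier N"
    if "Poly_Mapping.keys x \<subseteq> carrier M \<times> carrier N" for x
    using keys_frag_extend_frag_of[OF that, of "\<lambda>(m, n). (a \<odot>\<^bsub>M\<^esub> m, n)" "carrier M \<times> carrier N"] assms
    by (auto simp: M.l_closed)
  show ?thesis
  proof (rule homI; simp)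
    fix s t assume s: "s \<in> carrier (tensor_product B M N)"
    then show "a \<odot>\<^bsub>tensor_product B M N\<^esub> s \<in> carrier (tensor_product B M N)"
      by (rule tensor_carrierE) (simp only: tensor_smult_coset[OF assms] tensor_coset_closed k)
    assume t: "t \<in> carrier (tensor_product B M N)"
    obtain x where x: "Poly_Mapping.keys x \<subseteq> carrier M \<times> carrier N"
      "s = tensor_kernel B M N #>\<^bsub>tensor_free M N\<^esub> x" using s by (rule tensor_carrierE)
    obtain y where y: "Poly_Mapping.keys y \<subseteq> carrier M \<times> carrier N"
      "t = tensor_kernel B M N #>\<^bsub>tensor_free M N\<^esub> y" using t by (rule tensor_carrierE)
    show "a \<odot>\<^bsub>tensor_product B M N\<^esub> (s \<oplus>\<^bsub>tensor_product B M N\<^esub> t) =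
        a \<odot>\<^bsub>tensor_product B M N\<^esub> s \<oplus>\<^bsub>tensor_product B M N\<^esub> a \<odot>\<^bsub>tensor_product B M N\<^esub> t"
      unfolding x(2) y(2)
      by (simp only: tensor_add_coset x(1) y(1) tensor_smult_coset[OF assms] frag_extend_add k)
  qed
qed

lemma tensor_rsmult_hom:
  assumes "c \<in> carrier C"
  shows "(\<lambda>t. t \<triangleleft>\<^bsub>tensor_product B M N\<^esub> c) \<in>
    hom (add_monoid (tensor_product B M N)) (add_monoid (tensor_product B M N))"
proof -
  let ?f = "frag_extend (frag_of \<circ> (\<lambda>(m, n). (m, n \<triangleleft>\<^bsub>N\<^esub> c)))"
  have k: "Poly_Mapping.keys (?f x) \<subseteq> carrier M \<times> carrier N"
    if "Poly_Mapping.keys x \<subseteq> carrier M \<times> carrier N" for x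
    using keys_frag_extend_frag_of[OF that, of "\<lambda>(m, n). (m, n \<triangleleft>\<^bsub>N\<^esub> c)" "carrier M \<times> carrier N"] assms
    by (auto simp: N.r_closed)
  show ?thesis
  proof (rule homI; simp)
    fix s t assume s: "s \<in> carrier (tensor_product B M N)"
    then show "s \<triangleleft>\<^bsub>tensor_product B M N\<^esub> c \<in> carrier (tensor_product B M N)"
      by (rule tensor_carrierE) (simp only: tensor_rsmult_coset[OF assms] tensor_coset_closed k)
    assume t: "t \<in> carrier (tensor_product B M N)"
    obtain x where x: "Poly_Mapping.keys x \<subseteq> carrier M \<times> carrier N"
      "s = tensor_kernel B M N #>\<^bsub>tensor_free M N\<^esub> x" using s by (rule tensor_carrierE)
    obtain y where y: "Poly_Mapping.keys y \<subseteq> carrier M \<times> carrier N"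
      "t = tensor_kernel B M N #>\<^bsub>tensor_free M N\<^esub> y" using t by (rule tensor_carrierE)
    show "(s \<oplus>\<^bsub>tensor_product B M N\<^esub> t) \<triangleleft>\<^bsub>tensor_product B M N\<^esub> c =
        s \<triangleleft>\<^bsub>tensor_product B M N\<^esub> c \<oplus>\<^bsub>tensor_product B M N\<^esub> t \<triangleleft>\<^bsub>tensor_product B M N\<^esub> c"
      unfolding x(2) y(2)
      by (simp only: tensor_add_coset x(1) y(1) tensor_rsmult_coset[OF assms] frag_extend_add k)
  qed
qed

lemma tensor_hom_eqI:
  fixes G :: "('g, 'w) ring_scheme"
  assumes G: "abelian_group G"
    and f: "f \<in> hom (add_monoid (tensor_product B M N)) (add_monoid G)"
    and g: "g \<in> hom (add_monoid (tensor_product B M N)) (add_monoid G)"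
    and pure: "\<And>m n. m \<in> carrier M \<Longrightarrow> n \<in> carrier N \<Longrightarrow>
      f (pure_tensor B M N m n) = g (pure_tensor B M N m n)"
    and t: "t \<in> carrier (tensor_product B M N)"
  shows "f t = g t"
proof -
  interpret T: abelian_group "tensor_product B M N" by (rule tensor_abelian_group)
  interpret G: abelian_group G by (rule G)
  interpret f: abelian_group_hom "tensor_product B M N" G f
    using f by (intro abelian_group_homI tensor_abelian_group G)
      (simp add: group_hom_def group_hom_axioms_def T.a_group G.a_group)
  interpret g: abelian_group_hom "tensor_product B M N" G g
    using g by (intro abelian_group_homI tensor_abelian_group G)
      (simp add: group_hom_def group_hom_axioms_def T.a_group G.a_group)
  from t show ?thesis
    by (induction t rule: tensor_induct) (simp_all add: pure a_minus_def)
qed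

lemma tensor_bimodule: "bimodule A C (tensor_product B M N)"
proof -
  interpret T: abelian_group "tensor_product B M N" by (rule tensor_abelian_group)
  note sh = tensor_smult_hom and rh = tensor_rsmult_hom
  note eqI = tensor_hom_eqI[OF tensor_abelian_group]
  have idh: "(\<lambda>t. t) \<in> hom (add_monoid (tensor_product B M N)) (add_monoid (tensor_product B M N))"
    by (simp add: hom_def)
  have addh: "(\<lambda>t. f t \<oplus>\<^bsub>tensor_product B M N\<^esub> g t) \<in>
      hom (add_monoid (tensor_product B M N)) (add_monoid (tensor_product B M N))"
    if "f \<in> hom (add_monoid (tensor_product B M N)) (add_monoid (tensor_product B M N))"
      "g \<in> hom (add_monoid (tensor_product B M N)) (add_monoid (tensor_product B M N))" for f g
    using that by (auto simp: hom_def Pi_iff T.a_ac)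
  have comph: "(\<lambda>t. f (g t)) \<in> hom (add_monoid (tensor_product B M N)) (add_monoid (tensor_product B M N))"
    if "f \<in> hom (add_monoid (tensor_product B M N)) (add_monoid (tensor_product B M N))"
      "g \<in> hom (add_monoid (tensor_product B M N)) (add_monoid (tensor_product B M N))" for f g
    using that by (auto simp: hom_def Pi_iff)
  note ps = pure_tensor_smult pure_tensor_rsmult
  show ?thesis
  proof (intro bimodule.intro bimodule_axioms.intro M.A.ring_axioms N.B.ring_axioms tensor_abelian_group)
    fix a t assume "a \<in> carrier A" "t \<in> carrier (tensor_product B M N)"
    then show "a \<odot>\<^bsub>tensor_product B M N\<^esub> t \<in> carrier (tensor_product B M N)"
      using sh by (auto simp: hom_def)
  next
    fix c t assume "t \<in> carrier (tensor_product B M N)" "c \<in> carrier C"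
    then show "t \<triangleleft>\<^bsub>tensor_product B M N\<^esub> c \<in> carrier (tensor_product B M N)"
      using rh by (auto simp: hom_def)
  next
    fix a t u assume "a \<in> carrier A" "t \<in> carrier (tensor_product B M N)" "u \<in> carrier (tensor_product B M N)"
    then show "a \<odot>\<^bsub>tensor_product B M N\<^esub> (t \<oplus>\<^bsub>tensor_product B M N\<^esub> u) =
      a \<odot>\<^bsub>tensor_product B M N\<^esub> t \<oplus>\<^bsub>tensor_product B M N\<^esub> a \<odot>\<^bsub>tensor_product B M N\<^esub> u"
      using sh by (auto simp: hom_def)
  next
    fix c t u assume "c \<in> carrier C" "t \<in> carrier (tensor_product B M N)" "u \<in> carrier (tensor_product B M N)"
    then show "(t \<oplus>\<^bsub>tensor_product B M N\<^esub> u) \<triangleleft>\<^bsub>tensor_product B M N\<^esub> c =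
      t \<triangleleft>\<^bsub>tensor_product B M N\<^esub> c \<oplus>\<^bsub>tensor_product B M N\<^esub> u \<triangleleft>\<^bsub>tensor_product B M N\<^esub> c"
      using rh by (auto simp: hom_def)
  next
    fix a a' t assume a: "a \<in> carrier A" "a' \<in> carrier A" and t: "t \<in> carrier (tensor_product B M N)"
    show "(a \<oplus>\<^bsub>A\<^esub> a') \<odot>\<^bsub>tensor_product B M N\<^esub> t =
      a \<odot>\<^bsub>tensor_product B M N\<^esub> t \<oplus>\<^bsub>tensor_product B M N\<^esub> a' \<odot>\<^bsub>tensor_product B M N\<^esub> t"
      by (rule eqI[OF sh addh[OF sh sh] _ t])
        (simp_all add: a ps M.l_distr_ring M.l_closed pure_tensor_add_left)
    show "(a \<otimes>\<^bsub>A\<^esub> a') \<odot>\<^bsub>tensor_product B M N\<^esub> t =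
      a \<odot>\<^bsub>tensor_product B M N\<^esub> (a' \<odot>\<^bsub>tensor_product B M N\<^esub> t)"
      by (rule eqI[OF sh comph[OF sh sh] _ t]) (simp_all add: a ps M.l_assoc)
  next
    fix c c' t assume c: "c \<in> carrier C" "c' \<in> carrier C" and t: "t \<in> carrier (tensor_product B M N)"
    show "t \<triangleleft>\<^bsub>tensor_product B M N\<^esub> (c \<oplus>\<^bsub>C\<^esub> c') =
      t \<triangleleft>\<^bsub>tensor_product B M N\<^esub> c \<oplus>\<^bsub>tensor_product B M N\<^esub> t \<triangleleft>\<^bsub>tensor_product B M N\<^esub> c'"
      by (rule eqI[OF rh addh[OF rh rh] _ t])
        (simp_all add: c ps N.r_distr_ring N.r_closed pure_tensor_add_right)
    show "t \<triangleleft>\<^bsub>tensor_product B M N\<^esub> (c \<otimes>\<^bsub>C\<^esub> c') =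
      (t \<triangleleft>\<^bsub>tensor_product B M N\<^esub> c) \<triangleleft>\<^bsub>tensor_product B M N\<^esub> c'"
      by (rule eqI[OF rh comph[OF rh rh] _ t]) (simp_all add: c ps N.r_assoc)
  next
    fix t assume t: "t \<in> carrier (tensor_product B M N)"
    show "\<one>\<^bsub>A\<^esub> \<odot>\<^bsub>tensor_product B M N\<^esub> t = t"
      by (rule eqI[OF sh idh _ t]) (simp_all add: ps M.l_one)
    show "t \<triangleleft>\<^bsub>tensor_product B M N\<^esub> \<one>\<^bsub>C\<^esub> = t"
      by (rule eqI[OF rh idh _ t]) (simp_all add: ps N.r_one)
  next
    fix a t c assume a: "a \<in> carrier A" and t: "t \<in> carrier (tensor_product B M N)" and c: "c \<in> carrier C"
    show "(a \<odot>\<^bsub>tensor_product B M N\<^esub> t) \<triangleleft>\<^bsub>tensor_product B M N\<^esub> c =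
      a \<odot>\<^bsub>tensor_product B M N\<^esub> (t \<triangleleft>\<^bsub>tensor_product B M N\<^esub> c)"
      by (rule eqI[OF comph[OF rh sh] comph[OF sh rh] _ t]) (simp_all add: a c ps)
  qed
qed

end


section \<open>Morita contexts\<close>

text \<open>Under the identifications of \<open>M \<otimes>\<^sub>B B\<close> and \<open>A \<otimes>\<^sub>A M\<close> with \<open>M\<close>, the two homomorphisms
  \<open>Id\<^sub>M \<otimes>\<^sub>B \<psi>\<close> and \<open>\<phi> \<otimes>\<^sub>A Id\<^sub>M\<close> send \<open>m \<otimes> n \<otimes> m'\<close> to \<open>m \<psi>(n \<otimes> m')\<close> and \<open>\<phi>(m \<otimes> n) m'\<close>;
  their equality is the first associativity axiom. The second one is the same for \<open>N\<close>.\<close>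

locale morita_context = A: ring A + B: ring B + M: bimodule A B M + N: bimodule B A N
  for A :: "('a, 'x) ring_scheme" and B :: "('b, 'y) ring_scheme"
    and M :: "('a, 'b, 'm) bimodule" and N :: "('b, 'a, 'n) bimodule"
    and \<phi> :: "('m \<times> 'n \<Rightarrow>\<^sub>0 int) set \<Rightarrow> 'a" and \<psi> :: "('n \<times> 'm \<Rightarrow>\<^sub>0 int) set \<Rightarrow> 'b" +
  assumes \<phi>_hom: "\<phi> \<in> bimodule_hom A A (tensor_product B M N) (regular_bimodule A)"
    and \<psi>_hom: "\<psi> \<in> bimodule_hom B B (tensor_product A N M) (regular_bimodule B)"
    and assoc_M: "\<lbrakk>m \<in> carrier M; n \<in> carrier N; m' \<in> carrier M\<rbrakk>
      \<Longrightarrow> m \<triangleleft>\<^bsub>M\<^esub> \<psi> (pure_tensor A N M n m') = \<phi> (pure_tensor B M N m n) \<odot>\<^bsub>M\<^esub> m'"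
    and assoc_N: "\<lbrakk>n \<in> carrier N; m \<in> carrier M; n' \<in> carrier N\<rbrakk>
      \<Longrightarrow> n \<triangleleft>\<^bsub>N\<^esub> \<phi> (pure_tensor B M N m n') = \<psi> (pure_tensor A N M n m) \<odot>\<^bsub>N\<^esub> n'"

text \<open>The matrix with rows \<open>(a, m)\<close> and \<open>(n, b)\<close> is encoded as the pair of its rows.\<close>

definition morita_context_ring :: "('a, 'x) ring_scheme \<Rightarrow> ('b, 'y) ring_scheme \<Rightarrow>
    ('a, 'b, 'm) bimodule \<Rightarrow> ('b, 'a, 'n) bimodule \<Rightarrow>
    (('m \<times> 'n \<Rightarrow>\<^sub>0 int) set \<Rightarrow> 'a) \<Rightarrow> (('n \<times> 'm \<Rightarrow>\<^sub>0 int) set \<Rightarrow> 'b) \<Rightarrow>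
    (('a \<times> 'm) \<times> ('n \<times> 'b)) ring" where
  "morita_context_ring A B M N \<phi> \<psi> =
    \<lparr>carrier = (carrier A \<times> carrier M) \<times> (carrier N \<times> carrier B),
     monoid.mult = (\<lambda>((a, m), (n, b)) ((a', m'), (n', b')).
       ((a \<otimes>\<^bsub>A\<^esub> a' \<oplus>\<^bsub>A\<^esub> \<phi> (pure_tensor B M N m n'), a \<odot>\<^bsub>M\<^esub> m' \<oplus>\<^bsub>M\<^esub> m \<triangleleft>\<^bsub>M\<^esub> b'),
        (n \<triangleleft>\<^bsub>N\<^esub> a' \<oplus>\<^bsub>N\<^esub> b \<odot>\<^bsub>N\<^esub> n', \<psi> (pure_tensor A N M n m') \<oplus>\<^bsub>B\<^esub> b \<otimes>\<^bsub>B\<^esub> b'))),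
     monoid.one = ((\<one>\<^bsub>A\<^esub>, \<zero>\<^bsub>M\<^esub>), (\<zero>\<^bsub>N\<^esub>, \<one>\<^bsub>B\<^esub>)),
     ring.zero = ((\<zero>\<^bsub>A\<^esub>, \<zero>\<^bsub>M\<^esub>), (\<zero>\<^bsub>N\<^esub>, \<zero>\<^bsub>B\<^esub>)),
     ring.add = (\<lambda>((a, m), (n, b)) ((a', m'), (n', b')).
       ((a \<oplus>\<^bsub>A\<^esub> a', m \<oplus>\<^bsub>M\<^esub> m'), (n \<oplus>\<^bsub>N\<^esub> n', b \<oplus>\<^bsub>B\<^esub> b')))\<rparr>"

text \<open>\<open>MN\<close> is \<open>trace_ideal B M N \<phi>\<close> and \<open>NM\<close> is \<open>trace_ideal A N M \<psi>\<close>.\<close>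

definition trace_ideal :: "('b, 'y) ring_scheme \<Rightarrow> ('a, 'b, 'm) bimodule \<Rightarrow>
    ('b, 'a, 'n) bimodule \<Rightarrow> (('m \<times> 'n \<Rightarrow>\<^sub>0 int) set \<Rightarrow> 'a) \<Rightarrow> 'a set" where
  "trace_ideal B M N \<phi> = \<phi> ` carrier (tensor_product B M N)"


lemma regular_bimodule: "ring R \<Longrightarrow> bimodule R R (regular_bimodule R)"
proof -
  assume "ring R"
  then interpret ring R .
  have "abelian_group (regular_bimodule R)"
    by (rule abelian_groupI) (auto simp: regular_bimodule_def a_ac intro: l_neg)
  then show ?thesis
    by (intro bimodule.intro bimodule_axioms.intro ring_axioms)
      (simp_all add: regular_bimodule_def l_distr r_distr m_assoc)
qed

context morita_context
begin

lemma
  shows \<phi>_closed: "\<lbrakk>m \<in> carrier M; n \<in> carrier N\<rbrakk> \<Longrightarrow> \<phi> (pure_tensor B M N m n) \<in> carrier A"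
    and \<phi>_add_left: "\<lbrakk>m \<in> carrier M; m' \<in> carrier M; n \<in> carrier N\<rbrakk>
      \<Longrightarrow> \<phi> (pure_tensor B M N (m \<oplus>\<^bsub>M\<^esub> m') n) = \<phi> (pure_tensor B M N m n) \<oplus>\<^bsub>A\<^esub> \<phi> (pure_tensor B M N m' n)"
    and \<phi>_add_right: "\<lbrakk>m \<in> carrier M; n \<in> carrier N; n' \<in> carrier N\<rbrakk>
      \<Longrightarrow> \<phi> (pure_tensor B M N m (n \<oplus>\<^bsub>N\<^esub> n')) = \<phi> (pure_tensor B M N m n) \<oplus>\<^bsub>A\<^esub> \<phi> (pure_tensor B M N m n')"
    and \<phi>_balanced: "\<lbrakk>m \<in> carrier M; b \<in> carrier B; n \<in> carrier N\<rbrakk>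
      \<Longrightarrow> \<phi> (pure_tensor B M N (m \<triangleleft>\<^bsub>M\<^esub> b) n) = \<phi> (pure_tensor B M N m (b \<odot>\<^bsub>N\<^esub> n))"
    and \<phi>_left: "\<lbrakk>a \<in> carrier A; m \<in> carrier M; n \<in> carrier N\<rbrakk>
      \<Longrightarrow> \<phi> (pure_tensor B M N (a \<odot>\<^bsub>M\<^esub> m) n) = a \<otimes>\<^bsub>A\<^esub> \<phi> (pure_tensor B M N m n)"
    and \<phi>_right: "\<lbrakk>a \<in> carrier A; m \<in> carrier M; n \<in> carrier N\<rbrakk>
      \<Longrightarrow> \<phi> (pure_tensor B M N m (n \<triangleleft>\<^bsub>N\<^esub> a)) = \<phi> (pure_tensor B M N m n) \<otimes>\<^bsub>A\<^esub> a"
proof -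
  note t = pure_tensor_closed[OF M.bimodule_axioms N.bimodule_axioms]
  note h = \<phi>_hom[unfolded bimodule_hom_def regular_bimodule_def hom_def, simplified]
  show "\<phi> (pure_tensor B M N m n) \<in> carrier A" if "m \<in> carrier M" "n \<in> carrier N" for m n
    using h t[OF that] by auto
  show "\<phi> (pure_tensor B M N (m \<oplus>\<^bsub>M\<^esub> m') n) = \<phi> (pure_tensor B M N m n) \<oplus>\<^bsub>A\<^esub> \<phi> (pure_tensor B M N m' n)"
    if "m \<in> carrier M" "m' \<in> carrier M" "n \<in> carrier N" for m m' n
    using h that by (simp add: pure_tensor_add_left[OF M.bimodule_axioms N.bimodule_axioms] t)
  show "\<phi> (pure_tensor B M N m (n \<oplus>\<^bsub>N\<^esub> n')) = \<phi> (pure_tensor B M N m n) \<oplus>\<^bsub>A\<^esub> \<phi> (pure_tensor B M N m n')"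
    if "m \<in> carrier M" "n \<in> carrier N" "n' \<in> carrier N" for m n n'
    using h that by (simp add: pure_tensor_add_right[OF M.bimodule_axioms N.bimodule_axioms] t)
  show "\<phi> (pure_tensor B M N (m \<triangleleft>\<^bsub>M\<^esub> b) n) = \<phi> (pure_tensor B M N m (b \<odot>\<^bsub>N\<^esub> n))"
    if "m \<in> carrier M" "b \<in> carrier B" "n \<in> carrier N" for m b n
    using that by (simp add: pure_tensor_balanced[OF M.bimodule_axioms N.bimodule_axioms])
  show "\<phi> (pure_tensor B M N (a \<odot>\<^bsub>M\<^esub> m) n) = a \<otimes>\<^bsub>A\<^esub> \<phi> (pure_tensor B M N m n)"
    if "a \<in> carrier A" "m \<in> carrier M" "n \<in> carrier N" for a m n
    using h that by (simp flip: pure_tensor_smult[OF M.bimodule_axioms N.bimodule_axioms] add: t)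
  show "\<phi> (pure_tensor B M N m (n \<triangleleft>\<^bsub>N\<^esub> a)) = \<phi> (pure_tensor B M N m n) \<otimes>\<^bsub>A\<^esub> a"
    if "a \<in> carrier A" "m \<in> carrier M" "n \<in> carrier N" for a m n
    using h that by (simp flip: pure_tensor_rsmult[OF M.bimodule_axioms N.bimodule_axioms] add: t)
qed

lemma trace_ideal_is_ideal: "ideal (trace_ideal B M N \<phi>) A"
proof -
  interpret T: bimodule A A "tensor_product B M N"
    by (rule tensor_bimodule[OF M.bimodule_axioms N.bimodule_axioms])
  note h = \<phi>_hom[unfolded bimodule_hom_def regular_bimodule_def, simplified]
  have g: "\<phi> \<in> hom (add_monoid (tensor_product B M N)) (add_monoid A)"
    using h by (simp add: hom_def)
  interpret \<phi>: group_hom "add_monoid (tensor_product B M N)" "add_monoid A" \<phi>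
    using g by (simp add: group_hom_def group_hom_axioms_def T.M.a_group A.a_group)
  show ?thesis
  proof (rule idealI[OF A.ring_axioms])
    show "subgroup (trace_ideal B M N \<phi>) (add_monoid A)"
      using \<phi>.img_is_subgroup by (simp add: trace_ideal_def)
  next
    fix x y assume "x \<in> trace_ideal B M N \<phi>" and y: "y \<in> carrier A"
    then obtain t where t: "t \<in> carrier (tensor_product B M N)" "x = \<phi> t"
      by (auto simp: trace_ideal_def)
    have "y \<otimes>\<^bsub>A\<^esub> x = \<phi> (y \<odot>\<^bsub>tensor_product B M N\<^esub> t)"
      using h y t by simp
    then show "y \<otimes>\<^bsub>A\<^esub> x \<in> trace_ideal B M N \<phi>"
      using T.l_closed[OF y t(1)] by (simp add: trace_ideal_def)
    have "x \<otimes>\<^bsub>A\<^esub> y = \<phi> (t \<triangleleft>\<^bsub>tensor_product B M N\<^esub> y)"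
      using h y t by simp
    then show "x \<otimes>\<^bsub>A\<^esub> y \<in> trace_ideal B M N \<phi>"
      using T.r_closed[OF t(1) y] by (simp add: trace_ideal_def)
  qed
qed

lemma swap: "morita_context B A N M \<psi> \<phi>"
  by (intro morita_context.intro morita_context_axioms.intro A.ring_axioms B.ring_axioms
      M.bimodule_axioms N.bimodule_axioms \<phi>_hom \<psi>_hom) (simp_all add: assoc_M assoc_N)

end

context morita_context
begin

lemmas \<psi>_simps = morita_context.\<phi>_closed[OF swap] morita_context.\<phi>_add_left[OF swap]
  morita_context.\<phi>_add_right[OF swap] morita_context.\<phi>_balanced[OF swap]
  morita_context.\<phi>_left[OF swap] morita_context.\<phi>_right[OF swap]

lemma ring_morita_context_ring: "ring (morita_context_ring A B M N \<phi> \<psi>)"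
proof -
  let ?R = "morita_context_ring A B M N \<phi> \<psi>"
  note closed = \<phi>_closed M.l_closed M.r_closed N.l_closed N.r_closed
    morita_context.\<phi>_closed[OF swap]
  note rules = \<phi>_add_left \<phi>_add_right \<phi>_balanced \<phi>_left \<phi>_right \<psi>_simps
    M.l_distr_ring M.l_distr M.l_assoc M.l_one M.r_distr_ring M.r_distr M.r_assoc M.r_one M.lr_assoc
    N.l_distr_ring N.l_distr N.l_assoc N.l_one N.r_distr_ring N.r_distr N.r_assoc N.r_one N.lr_assoc
    A.l_distr A.r_distr A.m_assoc B.l_distr B.r_distr B.m_assoc assoc_M assoc_N
  note ac = M.M.a_ac N.M.a_ac A.a_ac B.a_ac
  have M_zero: "a \<odot>\<^bsub>M\<^esub> \<zero>\<^bsub>M\<^esub> = \<zero>\<^bsub>M\<^esub>" if "a \<in> carrier A" for a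
    using M.l_distr[of a "\<zero>\<^bsub>M\<^esub>" "\<zero>\<^bsub>M\<^esub>"] that by (simp add: M.l_closed)
  have zero_M: "\<zero>\<^bsub>M\<^esub> \<triangleleft>\<^bsub>M\<^esub> b = \<zero>\<^bsub>M\<^esub>" if "b \<in> carrier B" for b
    using M.r_distr[of b "\<zero>\<^bsub>M\<^esub>" "\<zero>\<^bsub>M\<^esub>"] that by (simp add: M.r_closed)
  have zero_A_M: "\<zero>\<^bsub>A\<^esub> \<odot>\<^bsub>M\<^esub> m = \<zero>\<^bsub>M\<^esub>" if "m \<in> carrier M" for m
    using M.l_distr_ring[of "\<zero>\<^bsub>A\<^esub>" "\<zero>\<^bsub>A\<^esub>" m] that by (simp add: M.l_closed)
  have M_zero_B: "m \<triangleleft>\<^bsub>M\<^esub> \<zero>\<^bsub>B\<^esub> = \<zero>\<^bsub>M\<^esub>" if "m \<in> carrier M" for m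
    using M.r_distr_ring[of "\<zero>\<^bsub>B\<^esub>" "\<zero>\<^bsub>B\<^esub>" m] that by (simp add: M.r_closed)
  have N_zero: "b \<odot>\<^bsub>N\<^esub> \<zero>\<^bsub>N\<^esub> = \<zero>\<^bsub>N\<^esub>" if "b \<in> carrier B" for b
    using N.l_distr[of b "\<zero>\<^bsub>N\<^esub>" "\<zero>\<^bsub>N\<^esub>"] that by (simp add: N.l_closed)
  have zero_N: "\<zero>\<^bsub>N\<^esub> \<triangleleft>\<^bsub>N\<^esub> a = \<zero>\<^bsub>N\<^esub>" if "a \<in> carrier A" for a
    using N.r_distr[of a "\<zero>\<^bsub>N\<^esub>" "\<zero>\<^bsub>N\<^esub>"] that by (simp add: N.r_closed)
  have zero_B_N: "\<zero>\<^bsub>B\<^esub> \<odot>\<^bsub>N\<^esub> n = \<zero>\<^bsub>N\<^esub>" if "n \<in> carrier N" for n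
    using N.l_distr_ring[of "\<zero>\<^bsub>B\<^esub>" "\<zero>\<^bsub>B\<^esub>" n] that by (simp add: N.l_closed)
  have N_zero_A: "n \<triangleleft>\<^bsub>N\<^esub> \<zero>\<^bsub>A\<^esub> = \<zero>\<^bsub>N\<^esub>" if "n \<in> carrier N" for n
    using N.r_distr_ring[of "\<zero>\<^bsub>A\<^esub>" "\<zero>\<^bsub>A\<^esub>" n] that by (simp add: N.r_closed)
  have \<phi>_zero: "\<phi> (pure_tensor B M N \<zero>\<^bsub>M\<^esub> n) = \<zero>\<^bsub>A\<^esub>" if "n \<in> carrier N" for n
    using \<phi>_add_left[of "\<zero>\<^bsub>M\<^esub>" "\<zero>\<^bsub>M\<^esub>" n] \<phi>_closed[of "\<zero>\<^bsub>M\<^esub>" n] that by simp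
  have \<phi>_zero': "\<phi> (pure_tensor B M N m \<zero>\<^bsub>N\<^esub>) = \<zero>\<^bsub>A\<^esub>" if "m \<in> carrier M" for m
    using \<phi>_add_right[of m "\<zero>\<^bsub>N\<^esub>" "\<zero>\<^bsub>N\<^esub>"] \<phi>_closed[of m "\<zero>\<^bsub>N\<^esub>"] that by simp
  have \<psi>_zero: "\<psi> (pure_tensor A N M \<zero>\<^bsub>N\<^esub> m) = \<zero>\<^bsub>B\<^esub>" if "m \<in> carrier M" for m
    using \<psi>_simps(2)[of "\<zero>\<^bsub>N\<^esub>" "\<zero>\<^bsub>N\<^esub>" m] \<psi>_simps(1)[of "\<zero>\<^bsub>N\<^esub>" m] that by simp
  have \<psi>_zero': "\<psi> (pure_tensor A N M n \<zero>\<^bsub>M\<^esub>) = \<zero>\<^bsub>B\<^esub>" if "n \<in> carrier N" for n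
    using \<psi>_simps(3)[of n "\<zero>\<^bsub>M\<^esub>" "\<zero>\<^bsub>M\<^esub>"] \<psi>_simps(1)[of n "\<zero>\<^bsub>M\<^esub>"] that by simp
  note zeros = M_zero zero_M zero_A_M M_zero_B N_zero zero_N zero_B_N N_zero_A
    \<phi>_zero \<phi>_zero' \<psi>_zero \<psi>_zero'
  show ?thesis
  proof (rule ringI)
    show "abelian_group ?R"
    proof (rule abelian_groupI)
      fix x assume "x \<in> carrier ?R"
      then show "\<exists>y\<in>carrier ?R. y \<oplus>\<^bsub>?R\<^esub> x = \<zero>\<^bsub>?R\<^esub>"
        by (cases x) (auto simp: morita_context_ring_def A.l_neg B.l_neg M.M.l_neg N.M.l_neg
            intro!: bexI[of _ "((\<ominus>\<^bsub>A\<^esub> fst (fst x), \<ominus>\<^bsub>M\<^esub> snd (fst x)), (\<ominus>\<^bsub>N\<^esub> fst (snd x), \<ominus>\<^bsub>B\<^esub> snd (snd x)))"])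
    qed (auto simp: morita_context_ring_def ac)
    show "Group.monoid ?R"
    proof (rule monoidI)
      fix x y z assume "x \<in> carrier ?R" "y \<in> carrier ?R" "z \<in> carrier ?R"
      then show "x \<otimes>\<^bsub>?R\<^esub> y \<otimes>\<^bsub>?R\<^esub> z = x \<otimes>\<^bsub>?R\<^esub> (y \<otimes>\<^bsub>?R\<^esub> z)"
        by (auto simp: morita_context_ring_def closed rules ac)
    qed (auto simp: morita_context_ring_def closed zeros rules)
  next
    fix x y z assume "x \<in> carrier ?R" "y \<in> carrier ?R" "z \<in> carrier ?R"
    then show "(x \<oplus>\<^bsub>?R\<^esub> y) \<otimes>\<^bsub>?R\<^esub> z = x \<otimes>\<^bsub>?R\<^esub> z \<oplus>\<^bsub>?R\<^esub> y \<otimes>\<^bsub>?R\<^esub> z"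
      and "z \<otimes>\<^bsub>?R\<^esub> (x \<oplus>\<^bsub>?R\<^esub> y) = z \<otimes>\<^bsub>?R\<^esub> x \<oplus>\<^bsub>?R\<^esub> z \<otimes>\<^bsub>?R\<^esub> y"
      by (auto simp: morita_context_ring_def closed rules ac)
  qed
qed

end

end

theory Submission
  imports Defs
begin

text \<open>Let \<open>P = MN\<close> and \<open>Q = NM\<close> be the trace ideals and \<open>R\<close> the Morita context ring.

  If \<open>R\<close> is \<open>n\<close>-UU, then for a unit \<open>u\<close> of \<open>A\<close> the matrix \<open>diag(u, 1)\<close> is a unit of \<open>R\<close>, and
  the upper left entry of the nilpotent matrix \<open>diag(u, 1)\<^sup>n - 1 = diag(u\<^sup>n - 1, 0)\<close> is nilpotent
  (\<open>n_UU_corner\<close>). The symmetry that exchanges \<open>A\<close> and \<open>B\<close> gives the same for \<open>B\<close>.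

  For the converse, products \<open>mn\<close> and \<open>nm\<close> vanish modulo the trace ideals, so reading off the
  diagonal gives ring homomorphisms from \<open>R\<close> to \<open>A/P\<close> and to \<open>B/Q\<close>. Being \<open>n\<close>-UU passes from
  \<open>A\<close> to \<open>A/P\<close> because units lift modulo nil ideals (\<open>n_UU_quotient_nilpotent_ideal\<close>), and it
  is pulled back along homomorphisms whose joint kernel is nil (\<open>n_UU_if_joint_kernel_nil\<close>). What
  remains is that the joint kernel, the ideal \<open>I\<close> of the matrices with diagonal entries in \<open>P\<close>
  and \<open>Q\<close>, is nil (\<open>nilpotent_if_mem_diag_ideal\<close>). The idea is that the entries in \<open>M\<close> can be
  measured by the powers of \<open>P\<close> as well, through the products that they form with \<open>N\<close>: every two
  multiplications by elements of \<open>I\<close> push the first row of a matrix one power of \<open>P\<close> deeper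
  (\<open>row_filtration_step\<close>), and the second row is the first row of the swapped context.\<close>

section \<open>Nil kernels and powers of ideals\<close>

text \<open>The inverse is the geometric series: its partial sums \<open>s\<close> satisfy
  \<open>(1 - x) s = 1 - x\<^sup>k\<close>, and also \<open>s (1 - x) = 1 - x\<^sup>k\<close>, since the powers of \<open>x\<close> commute with \<open>x\<close>.\<close>

lemma (in ring) one_minus_nilpotent_Units:
  assumes x: "x \<in> carrier R" and "nilpotent R x"
  shows "\<one> \<ominus> x \<in> Units R"
proof -
  have "\<exists>s\<in>carrier R. (\<one> \<ominus> x) \<otimes> s = \<one> \<ominus> x [^] k \<and> s \<otimes> (\<one> \<ominus> x) = \<one> \<ominus> x [^] k" for k :: nat
  proof (induction k)
    case 0
    show ?case using x by (intro bexI[of _ \<zero>]) (simp_all add: a_minus_def r_neg)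
  next
    case (Suc k)
    then obtain s where s: "s \<in> carrier R" "(\<one> \<ominus> x) \<otimes> s = \<one> \<ominus> x [^] k"
      "s \<otimes> (\<one> \<ominus> x) = \<one> \<ominus> x [^] k" by blast
    have telescope: "(\<one> \<ominus> x [^] k) \<oplus> (x [^] k \<ominus> x [^] Suc k) = \<one> \<ominus> x [^] Suc k"
      using x by (simp add: a_minus_def a_assoc r_neg1 del: nat_pow_Suc)
    have "(\<one> \<ominus> x) \<otimes> x [^] k = x [^] k \<ominus> x [^] Suc k"
      using x by (simp only: nat_pow_Suc2) (simp add: a_minus_def l_distr l_minus)
    moreover have "x [^] k \<otimes> (\<one> \<ominus> x) = x [^] k \<ominus> x [^] Suc k"
      using x by (simp add: a_minus_def r_distr r_minus)
    ultimately show ?case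
      using s x telescope by (intro bexI[of _ "s \<oplus> x [^] k"]) (simp_all add: l_distr r_distr del: nat_pow_Suc)
  qed
  moreover obtain k :: nat where "x [^] k = \<zero>"
    using assms(2) by (auto simp: nilpotent_def)
  ultimately obtain s where "s \<in> carrier R" "(\<one> \<ominus> x) \<otimes> s = \<one>" "s \<otimes> (\<one> \<ominus> x) = \<one>"
    by (metis a_minus_def minus_zero r_zero one_closed)
  then show ?thesis using x by (auto simp: Units_def)
qed

text \<open>The two products provide a right and a left inverse of \<open>x\<close>, and these must agree.\<close>

lemma (in monoid) Units_if_products_Units:
  assumes x: "x \<in> carrier G" and y: "y \<in> carrier G"
    and xy: "x \<otimes> y \<in> Units G" and yx: "y \<otimes> x \<in> Units G"
  shows "x \<in> Units G"
proof -
  let ?r = "y \<otimes> inv (x \<otimes> y)" and ?l = "inv (y \<otimes> x) \<otimes> y"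
  have r: "?r \<in> carrier G" "x \<otimes> ?r = \<one>"
    using x y xy by (simp_all flip: m_assoc)
  have l: "?l \<in> carrier G" "?l \<otimes> x = \<one>"
    using x y yx by (simp_all add: m_assoc)
  have "?l = ?r" using inv_unique[OF l(2) r(2) x l(1) r(1)] .
  then show ?thesis using x r l by (auto simp: Units_def)
qed

lemma (in ring_hom_ring) hom_minus:
  "x \<in> carrier R \<Longrightarrow> y \<in> carrier R \<Longrightarrow> h (x \<ominus> y) = h x \<ominus>\<^bsub>S\<^esub> h y"
  by (simp add: a_minus_def R.minus_eq S.minus_eq)

lemma (in ring_hom_ring) hom_Units:
  "u \<in> Units R \<Longrightarrow> h u \<in> Units S"
proof -
  assume u: "u \<in> Units R"
  have "h u \<otimes>\<^bsub>S\<^esub> h (inv u) = h (u \<otimes> inv u)" "h (inv u) \<otimes>\<^bsub>S\<^esub> h u = h (inv u \<otimes> u)"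
    using u by (simp_all only: hom_mult R.Units_closed R.Units_inv_closed)
  then have "h u \<otimes>\<^bsub>S\<^esub> h (inv u) = \<one>\<^bsub>S\<^esub>" "h (inv u) \<otimes>\<^bsub>S\<^esub> h u = \<one>\<^bsub>S\<^esub>"
    using u by (simp_all only: R.Units_r_inv R.Units_l_inv hom_one)
  then show ?thesis
    using u unfolding Units_def[of S]
    by (intro CollectI conjI bexI[of _ "h (inv u)"]) (simp_all only: hom_closed R.Units_closed R.Units_inv_closed)
qed

text \<open>Anything that maps to \<open>1\<close> is \<open>1\<close> minus a nilpotent element, hence a unit. This applies to the
  products of \<open>x\<close> with a preimage of the inverse of \<open>h x\<close>, on either side.\<close>

lemma (in ring_hom_ring) Units_lift:
  assumes surj: "h ` carrier R = carrier S"
    and nil: "\<And>x. x \<in> carrier R \<Longrightarrow> h x = \<zero>\<^bsub>S\<^esub> \<Longrightarrow> nilpotent R x"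
    and x: "x \<in> carrier R" and hx: "h x \<in> Units S"
  shows "x \<in> Units R"
proof -
  have unit: "z \<in> Units R" if z: "z \<in> carrier R" and hz: "h z = \<one>\<^bsub>S\<^esub>" for z
  proof -
    have 1: "\<one>\<^bsub>R\<^esub> \<ominus> z \<in> carrier R" using z by simp
    have "nilpotent R (\<one>\<^bsub>R\<^esub> \<ominus> z)"
      using z hz by (intro nil) (simp_all add: hom_minus S.minus_eq S.r_neg)
    then have "\<one>\<^bsub>R\<^esub> \<ominus> (\<one>\<^bsub>R\<^esub> \<ominus> z) \<in> Units R"
      by (rule R.one_minus_nilpotent_Units[OF 1])
    moreover have "\<one>\<^bsub>R\<^esub> \<ominus> (\<one>\<^bsub>R\<^esub> \<ominus> z) = z"
      using z by (simp add: R.minus_eq R.minus_add R.r_neg2)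
    ultimately show ?thesis by simp
  qed
  have "inv\<^bsub>S\<^esub> (h x) \<in> h ` carrier R"
    unfolding surj using hx by (rule S.Units_inv_closed)
  then obtain y where y: "y \<in> carrier R" "h y = inv\<^bsub>S\<^esub> (h x)"
    by (elim imageE) simp
  have "h (x \<otimes>\<^bsub>R\<^esub> y) = \<one>\<^bsub>S\<^esub>" "h (y \<otimes>\<^bsub>R\<^esub> x) = \<one>\<^bsub>S\<^esub>"
    using hx by (simp_all add: x y)
  then show ?thesis
    using x y(1) by (intro R.Units_if_products_Units[OF x y(1)]) (simp_all only: unit R.m_closed)
qed

lemma (in ring_hom_ring) n_UU_image:
  assumes surj: "h ` carrier R = carrier S"
    and nil: "\<And>x. x \<in> carrier R \<Longrightarrow> h x = \<zero>\<^bsub>S\<^esub> \<Longrightarrow> nilpotent R x"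
    and "n_UU n R"
  shows "n_UU n S"
  unfolding n_UU_def
proof
  fix v assume v: "v \<in> Units S"
  then have "v \<in> h ` carrier R" unfolding surj by (rule S.Units_closed)
  then obtain u where u: "u \<in> carrier R" "h u = v" by (elim imageE) simp
  have "h u \<in> Units S" using v by (simp only: u(2))
  then have "u \<in> Units R" by (intro Units_lift[OF surj _ u(1)] nil)
  then obtain k :: nat where "(u [^]\<^bsub>R\<^esub> n \<ominus> \<one>\<^bsub>R\<^esub>) [^]\<^bsub>R\<^esub> k = \<zero>\<^bsub>R\<^esub>"
    using assms(3) by (auto simp: n_UU_def nilpotent_def)
  then have "h ((u [^]\<^bsub>R\<^esub> n \<ominus> \<one>\<^bsub>R\<^esub>) [^]\<^bsub>R\<^esub> k) = \<zero>\<^bsub>S\<^esub>" by simp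
  then have "(v [^]\<^bsub>S\<^esub> n \<ominus>\<^bsub>S\<^esub> \<one>\<^bsub>S\<^esub>) [^]\<^bsub>S\<^esub> k = \<zero>\<^bsub>S\<^esub>"
    using u by (simp add: hom_nat_pow hom_minus)
  then show "nilpotent S (v [^]\<^bsub>S\<^esub> n \<ominus>\<^bsub>S\<^esub> \<one>\<^bsub>S\<^esub>)" by (auto simp: nilpotent_def)
qed

text \<open>If \<open>w = u\<^sup>n - 1\<close>, then a power of \<open>w\<close> lies in one kernel and a power in the other, so their
  product is a power of \<open>w\<close> in both. Two homomorphisms replace the single one to the product of
  \<open>S\<close> and \<open>T\<close>.\<close>

lemma n_UU_if_joint_kernel_nil:
  assumes "ring_hom_ring R S f" and "ring_hom_ring R T g"
    and nil: "\<And>x. x \<in> carrier R \<Longrightarrow> f x = \<zero>\<^bsub>S\<^esub> \<Longrightarrow> g x = \<zero>\<^bsub>T\<^esub> \<Longrightarrow> nilpotent R x"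
    and "n_UU n S" and "n_UU n T"
  shows "n_UU n R"
  unfolding n_UU_def
proof
  interpret f: ring_hom_ring R S f by fact
  interpret g: ring_hom_ring R T g by fact
  fix u assume u: "u \<in> Units R"
  define w where "w = u [^]\<^bsub>R\<^esub> n \<ominus>\<^bsub>R\<^esub> \<one>\<^bsub>R\<^esub>"
  have w: "w \<in> carrier R" using u by (simp add: w_def f.R.Units_closed)
  have "nilpotent S (f w)" "nilpotent T (g w)"
    using u f.hom_Units[OF u] g.hom_Units[OF u] assms(4,5)
    by (simp_all add: w_def n_UU_def f.hom_minus g.hom_minus f.hom_nat_pow g.hom_nat_pow f.R.Units_closed)
  then obtain k l :: nat where k: "f w [^]\<^bsub>S\<^esub> k = \<zero>\<^bsub>S\<^esub>" and l: "g w [^]\<^bsub>T\<^esub> l = \<zero>\<^bsub>T\<^esub>"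
    by (auto simp: nilpotent_def)
  let ?z = "w [^]\<^bsub>R\<^esub> k \<otimes>\<^bsub>R\<^esub> w [^]\<^bsub>R\<^esub> l"
  have "f ?z = \<zero>\<^bsub>S\<^esub>" "g ?z = \<zero>\<^bsub>T\<^esub>"
    using w k l by (simp_all add: f.hom_nat_pow g.hom_nat_pow)
  then have "nilpotent R (w [^]\<^bsub>R\<^esub> (k + l))"
    using nil[of ?z] w by (simp add: f.R.nat_pow_mult)
  then have "nilpotent R w"
    using w by (auto simp: nilpotent_def f.R.nat_pow_pow)
  then show "nilpotent R (u [^]\<^bsub>R\<^esub> n \<ominus>\<^bsub>R\<^esub> \<one>\<^bsub>R\<^esub>)" by (simp add: w_def)
qed

lemma (in ring) ideal_ideal_pow: "ideal I R \<Longrightarrow> ideal (ideal_pow R I k) R"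
  by (induction k) (simp_all add: oneideal ideal_prod_is_ideal)

lemma (in ring) ideal_pow_antimono:
  assumes "ideal I R" "i \<le> j"
  shows "ideal_pow R I j \<subseteq> ideal_pow R I i"
proof (rule lift_Suc_antimono_le[OF _ assms(2), of "ideal_pow R I"])
  show "ideal_pow R I (Suc n) \<subseteq> ideal_pow R I n" for n
    using ideal_prod_inter[OF ideal_ideal_pow[OF assms(1)] assms(1)] by auto
qed

lemma (in ring) pow_mem_ideal_pow:
  "x \<in> I \<Longrightarrow> x \<in> carrier R \<Longrightarrow> x [^] k \<in> ideal_pow R I k"
  by (induction k) (auto intro: ideal_prod.prod)

lemma nilpotent_if_mem_nilpotent_ideal:
  assumes "nilpotent_ideal I R" and "x \<in> I"
  shows "nilpotent R x"
proof -
  interpret ideal I R using assms(1) by (simp add: nilpotent_ideal_def)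
  obtain k where "ideal_pow R I k = {\<zero>\<^bsub>R\<^esub>}"
    using assms(1) by (auto simp: nilpotent_ideal_def)
  then have "x [^]\<^bsub>R\<^esub> k = \<zero>\<^bsub>R\<^esub>"
    using pow_mem_ideal_pow[OF assms(2) Icarr[OF assms(2)], of k] by simp
  then show ?thesis by (auto simp: nilpotent_def)
qed

lemma (in ideal) rcos_eq_zero_iff:
  "x \<in> carrier R \<Longrightarrow> I +> x = \<zero>\<^bsub>R Quot I\<^esub> \<longleftrightarrow> x \<in> I"
  using rcos_const_imp_mem a_rcos_const by (auto simp: FactRing_def)

lemma n_UU_quotient_nilpotent_ideal:
  assumes "nilpotent_ideal I R" and "n_UU n R"
  shows "n_UU n (R Quot I)"
proof -
  interpret ideal I R using assms(1) by (simp add: nilpotent_ideal_def)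
  interpret q: ring_hom_ring R "R Quot I" "(+>\<^bsub>R\<^esub>) I" by (rule rcos_ring_hom_ring)
  show ?thesis
  proof (rule q.n_UU_image[OF _ _ assms(2)])
    show "(+>\<^bsub>R\<^esub>) I ` carrier R = carrier (R Quot I)"
      by (simp only: FactRing_def A_RCOSETS_def' partial_object.simps UNION_singleton_eq_range)
    show "nilpotent R x" if "x \<in> carrier R" "I +>\<^bsub>R\<^esub> x = \<zero>\<^bsub>R Quot I\<^esub>" for x
      using that nilpotent_if_mem_nilpotent_ideal[OF assms(1)] by (simp only: rcos_eq_zero_iff)
  qed
qed


section \<open>The matrices of a Morita context\<close>

text \<open>Conjugation by the permutation matrix exchanges the roles of \<open>A\<close> and \<open>B\<close>. It turns statements
  about first rows and upper left corners into statements about second rows and lower right corners.\<close>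

lemma ring_hom_morita_swap:
  assumes "morita_context A B M N \<phi> \<psi>"
  shows "ring_hom_ring (morita_context_ring A B M N \<phi> \<psi>) (morita_context_ring B A N M \<psi> \<phi>)
    (\<lambda>((a, m), (n, b)). ((b, n), (m, a)))"
proof -
  interpret morita_context A B M N \<phi> \<psi> by fact
  show ?thesis
    by (intro ring_hom_ringI2 ring_morita_context_ring morita_context.ring_morita_context_ring[OF swap]
        ring_hom_memI)
      (auto simp: morita_context_ring_def \<phi>_closed \<psi>_simps(1) M.l_closed M.r_closed N.l_closed N.r_closed
        A.a_comm B.a_comm M.M.a_comm N.M.a_comm)
qed

context morita_context
begin

abbreviation mctx_ring where "mctx_ring \<equiv> morita_context_ring A B M N \<phi> \<psi>"

abbreviation MN where "MN \<equiv> trace_ideal B M N \<phi>"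

abbreviation NM where "NM \<equiv> trace_ideal A N M \<psi>"

abbreviation mn (infixl \<open>\<bullet>\<close> 70) where "m \<bullet> n \<equiv> \<phi> (pure_tensor B M N m n)"

lemma mn_mem_MN: "m \<in> carrier M \<Longrightarrow> n \<in> carrier N \<Longrightarrow> m \<bullet> n \<in> MN"
  unfolding trace_ideal_def
  by (intro imageI pure_tensor_closed[OF M.bimodule_axioms N.bimodule_axioms])

text \<open>The closure property is stated for differences, so that the claim for \<open>- a\<close> need not be shown
  separately.\<close>

lemma trace_ideal_induct [consumes 1, case_names pure zero diff]:
  assumes a: "a \<in> MN"
    and pure: "\<And>m n. m \<in> carrier M \<Longrightarrow> n \<in> carrier N \<Longrightarrow> P (m \<bullet> n)"
    and zero: "P \<zero>\<^bsub>A\<^esub>"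
    and diff: "\<And>a a'. a \<in> carrier A \<Longrightarrow> a' \<in> carrier A \<Longrightarrow> P a \<Longrightarrow> P a' \<Longrightarrow> P (a \<ominus>\<^bsub>A\<^esub> a')"
  shows "P a"
proof -
  interpret T: bimodule A A "tensor_product B M N"
    by (rule tensor_bimodule[OF M.bimodule_axioms N.bimodule_axioms])
  interpret \<phi>: abelian_group_hom "tensor_product B M N" A \<phi>
    using \<phi>_hom T.M.a_group A.a_group
    by (intro abelian_group_homI T.M.abelian_group_axioms A.abelian_group_axioms)
      (simp add: bimodule_hom_def regular_bimodule_def group_hom_def group_hom_axioms_def hom_def)
  obtain t where t: "t \<in> carrier (tensor_product B M N)" "a = \<phi> t"
    using a by (auto simp: trace_ideal_def)
  from t(1) have "P (\<phi> t)"
    by (induction t rule: tensor_induct[OF M.bimodule_axioms N.bimodule_axioms, consumes 1])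
      (use pure zero diff in \<open>simp_all add: A.minus_eq T.M.minus_eq\<close>)
  then show ?thesis by (simp add: t(2))
qed

lemma M_l_zero: "m \<in> carrier M \<Longrightarrow> \<zero>\<^bsub>A\<^esub> \<odot>\<^bsub>M\<^esub> m = \<zero>\<^bsub>M\<^esub>"
  using M.l_distr_ring[of "\<zero>\<^bsub>A\<^esub>" "\<zero>\<^bsub>A\<^esub>" m] by (simp add: M.l_closed)

lemma M_r_zero: "m \<in> carrier M \<Longrightarrow> m \<triangleleft>\<^bsub>M\<^esub> \<zero>\<^bsub>B\<^esub> = \<zero>\<^bsub>M\<^esub>"
  using M.r_distr_ring[of "\<zero>\<^bsub>B\<^esub>" "\<zero>\<^bsub>B\<^esub>" m] by (simp add: M.r_closed)

lemma M_r_minus: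
  assumes "m \<in> carrier M" "b \<in> carrier B" "b' \<in> carrier B"
  shows "m \<triangleleft>\<^bsub>M\<^esub> (b \<ominus>\<^bsub>B\<^esub> b') = m \<triangleleft>\<^bsub>M\<^esub> b \<ominus>\<^bsub>M\<^esub> m \<triangleleft>\<^bsub>M\<^esub> b'"
proof -
  have "m \<triangleleft>\<^bsub>M\<^esub> (b \<ominus>\<^bsub>B\<^esub> b') \<oplus>\<^bsub>M\<^esub> m \<triangleleft>\<^bsub>M\<^esub> b' = m \<triangleleft>\<^bsub>M\<^esub> b"
    using assms by (simp flip: M.r_distr_ring add: B.minus_eq B.a_assoc B.l_neg)
  then show ?thesis
    using assms by (metis M.M.add.inv_solve_right M.M.minus_eq B.minus_closed M.r_closed)
qed

lemma \<phi>_zero_left: "n \<in> carrier N \<Longrightarrow> \<zero>\<^bsub>M\<^esub> \<bullet> n = \<zero>\<^bsub>A\<^esub>"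
  using \<phi>_add_left[of "\<zero>\<^bsub>M\<^esub>" "\<zero>\<^bsub>M\<^esub>" n] \<phi>_closed[of "\<zero>\<^bsub>M\<^esub>" n] by simp

lemma \<phi>_minus_left:
  assumes "m \<in> carrier M" "m' \<in> carrier M" "n \<in> carrier N"
  shows "(m \<ominus>\<^bsub>M\<^esub> m') \<bullet> n = m \<bullet> n \<ominus>\<^bsub>A\<^esub> m' \<bullet> n"
proof -
  have "(m \<ominus>\<^bsub>M\<^esub> m') \<bullet> n \<oplus>\<^bsub>A\<^esub> m' \<bullet> n = m \<bullet> n"
    using assms by (simp flip: \<phi>_add_left add: M.M.minus_eq M.M.a_assoc M.M.l_neg)
  then show ?thesis
    using assms by (metis A.add.inv_solve_right A.minus_eq M.M.minus_closed \<phi>_closed)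
qed

text \<open>On a generator \<open>n'm'\<close> of \<open>NM\<close> associativity gives \<open>(m(n'm'))n = (mn')(m'n)\<close>, an element of \<open>J\<close>
  times an element of \<open>MN\<close>. Both sides are additive in the element of \<open>NM\<close>.\<close>

lemma mult_MN_step:
  assumes J: "ideal J A" and m: "m \<in> carrier M" and mN: "\<And>n. n \<in> carrier N \<Longrightarrow> m \<bullet> n \<in> J"
    and b: "b \<in> NM" and n: "n \<in> carrier N"
  shows "(m \<triangleleft>\<^bsub>M\<^esub> b) \<bullet> n \<in> J \<cdot>\<^bsub>A\<^esub> MN"
proof -
  interpret JP: ideal "J \<cdot>\<^bsub>A\<^esub> MN" A by (rule A.ideal_prod_is_ideal[OF J trace_ideal_is_ideal])
  show ?thesis using b
  proof (induction b rule: morita_context.trace_ideal_induct[OF swap, consumes 1])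
    case (1 n' m')
    have "(m \<triangleleft>\<^bsub>M\<^esub> \<psi> (pure_tensor A N M n' m')) \<bullet> n = (m \<bullet> n') \<otimes>\<^bsub>A\<^esub> (m' \<bullet> n)"
      using 1 m n by (simp add: assoc_M \<phi>_left \<phi>_closed)
    then show ?case using ideal_prod.prod[OF mN mn_mem_MN] 1 n by metis
  next
    case 2
    show ?case using m n by (simp add: M_r_zero \<phi>_zero_left)
  next
    case (3 b b')
    then show ?case
      using m n by (simp add: M_r_minus \<phi>_minus_left M.r_closed A.minus_eq)
  qed
qed

text \<open>The reason is again associativity, \<open>m(nm') = (mn)m'\<close>, now in \<open>M\<close> itself. A product \<open>mn\<close> may
  vanish for all \<open>n\<close> without \<open>m\<close> vanishing, so this provides the last step from products to entries.\<close>

lemma mult_NM_eq_zero: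
  assumes m: "m \<in> carrier M" and mN: "\<And>n. n \<in> carrier N \<Longrightarrow> m \<bullet> n = \<zero>\<^bsub>A\<^esub>" and b: "b \<in> NM"
  shows "m \<triangleleft>\<^bsub>M\<^esub> b = \<zero>\<^bsub>M\<^esub>"
  using b
proof (induction b rule: morita_context.trace_ideal_induct[OF swap, consumes 1])
  case (1 n m')
  then show ?case using m by (simp add: assoc_M mN M_l_zero)
next
  case 2
  show ?case using m by (rule M_r_zero)
next
  case (3 b b')
  then show ?case using m by (simp add: M_r_minus M.M.minus_eq)
qed

section \<open>Matrices with diagonal entries in the trace ideals\<close>

text \<open>The off-diagonal entry \<open>m\<close> is measured by the ideal that contains \<open>mN\<close>, rather than by
  submodules \<open>P\<^sup>jM\<close>: this condition is additive in \<open>m\<close> at once and involves no spans. The two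
  indices are separate because the two entries of the row move down alternately.\<close>

definition row_filtration :: "nat \<Rightarrow> nat \<Rightarrow> (('a \<times> 'm) \<times> ('n \<times> 'b)) set" where
  "row_filtration i j = {((a, m), (n, b)) | a m n b. ((a, m), (n, b)) \<in> carrier mctx_ring \<and>
     a \<in> ideal_pow A MN i \<and> (\<forall>n'\<in>carrier N. m \<bullet> n' \<in> ideal_pow A MN j)}"

definition diag_ideal :: "(('a \<times> 'm) \<times> ('n \<times> 'b)) set" where
  "diag_ideal = (MN \<times> carrier M) \<times> (carrier N \<times> NM)"

lemma diag_ideal_subset: "diag_ideal \<subseteq> carrier mctx_ring"
  using ideal.Icarr[OF trace_ideal_is_ideal] ideal.Icarr[OF morita_context.trace_ideal_is_ideal[OF swap]]
  by (auto simp: diag_ideal_def morita_context_ring_def)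

text \<open>For the first row \<open>(a, m)\<close> of the left factor and a matrix \<open>Z\<close> with rows \<open>(p, m')\<close> and
  \<open>(n', q)\<close>, the new diagonal entry is \<open>ap + mn'\<close>, with \<open>ap\<close> in \<open>P\<^sup>i\<^sup>+\<^sup>1\<close> and \<open>mn'\<close> in \<open>P\<^sup>j\<close>. The
  new off-diagonal entry is \<open>am' + mq\<close>, with \<open>(am')N\<close> in \<open>P\<^sup>i\<^sup>+\<^sup>1\<close> and \<open>(mq)N\<close> in \<open>P\<^sup>j\<^sup>+\<^sup>1\<close>. The
  bounds on \<open>i\<close> and \<open>j\<close> make \<open>j\<close> and \<open>i + 1\<close> the weaker exponents.\<close>

lemma row_filtration_step:
  assumes V: "V \<in> row_filtration i j" and Z: "Z \<in> diag_ideal" and ij: "i \<le> j" "j \<le> Suc i"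
  shows "V \<otimes>\<^bsub>mctx_ring\<^esub> Z \<in> row_filtration j (Suc i)"
proof -
  interpret R: ring mctx_ring by (rule ring_morita_context_ring)
  note P = trace_ideal_is_ideal
  note pow = A.ideal_ideal_pow[OF P]
  obtain a m n b where V_eq: "V = ((a, m), (n, b))" and Vc: "V \<in> carrier mctx_ring"
    and a: "a \<in> ideal_pow A MN i" and mN: "\<And>n'. n' \<in> carrier N \<Longrightarrow> m \<bullet> n' \<in> ideal_pow A MN j"
    using V by (auto simp: row_filtration_def)
  obtain p m' n' q where Z_eq: "Z = ((p, m'), (n', q))" and p: "p \<in> MN" and q: "q \<in> NM"
    using Z by (auto simp: diag_ideal_def)
  have Zc: "Z \<in> carrier mctx_ring" using Z diag_ideal_subset by blast
  have c: "a \<in> carrier A" "m \<in> carrier M" "m' \<in> carrier M" "n' \<in> carrier N" "q \<in> carrier B" "p \<in> carrier A"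
    using Vc Zc by (auto simp: V_eq Z_eq morita_context_ring_def)
  have "a \<otimes>\<^bsub>A\<^esub> p \<in> ideal_pow A MN (Suc i)" using ideal_prod.prod[OF a p] by simp
  then have "a \<otimes>\<^bsub>A\<^esub> p \<in> ideal_pow A MN j"
    using A.ideal_pow_antimono[OF P ij(2)] by blast
  then have diag: "a \<otimes>\<^bsub>A\<^esub> p \<oplus>\<^bsub>A\<^esub> m \<bullet> n' \<in> ideal_pow A MN j"
    using mN[OF c(4)] additive_subgroup.a_closed[OF ideal.axioms(1)[OF pow]] by blast
  have off: "(a \<odot>\<^bsub>M\<^esub> m' \<oplus>\<^bsub>M\<^esub> m \<triangleleft>\<^bsub>M\<^esub> q) \<bullet> n'' \<in> ideal_pow A MN (Suc i)" if n'': "n'' \<in> carrier N" for n''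
  proof -
    have "(a \<odot>\<^bsub>M\<^esub> m') \<bullet> n'' = a \<otimes>\<^bsub>A\<^esub> (m' \<bullet> n'')" using c n'' by (simp add: \<phi>_left)
    then have 1: "(a \<odot>\<^bsub>M\<^esub> m') \<bullet> n'' \<in> ideal_pow A MN (Suc i)"
      using ideal_prod.prod[OF a mn_mem_MN] c n'' by simp
    have "(m \<triangleleft>\<^bsub>M\<^esub> q) \<bullet> n'' \<in> ideal_pow A MN (Suc j)"
      using mult_MN_step[OF pow c(2) mN q n''] by simp
    then have 2: "(m \<triangleleft>\<^bsub>M\<^esub> q) \<bullet> n'' \<in> ideal_pow A MN (Suc i)"
      using A.ideal_pow_antimono[OF P, of "Suc i" "Suc j"] ij(1) by blast
    have "(a \<odot>\<^bsub>M\<^esub> m' \<oplus>\<^bsub>M\<^esub> m \<triangleleft>\<^bsub>M\<^esub> q) \<bullet> n'' = (a \<odot>\<^bsub>M\<^esub> m') \<bullet> n'' \<oplus>\<^bsub>A\<^esub> (m \<triangleleft>\<^bsub>M\<^esub> q) \<bullet> n''"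
      using c n'' by (simp add: \<phi>_add_left M.l_closed M.r_closed)
    then show ?thesis
      using 1 2 additive_subgroup.a_closed[OF ideal.axioms(1)[OF pow]] by metis
  qed
  have "V \<otimes>\<^bsub>mctx_ring\<^esub> Z \<in> carrier mctx_ring" using Vc Zc by simp
  then show ?thesis
    using diag off by (auto simp: row_filtration_def V_eq Z_eq morita_context_ring_def)
qed

text \<open>Start from the identity matrix, which has filtration indices \<open>(0, 0)\<close>. Two steps lead from
  \<open>(i, i)\<close> through \<open>(i, i + 1)\<close> to \<open>(i + 1, i + 1)\<close>. Once \<open>P\<^sup>k = 0\<close>, the first row of \<open>Z\<^sup>2\<^sup>k\<close> is
  \<open>(0, m)\<close> with \<open>mN = 0\<close>, and one more factor \<open>Z\<close> removes \<open>m\<close>.\<close>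

lemma first_row_pow_eq_zero:
  assumes nil: "nilpotent_ideal MN A" and Z: "Z \<in> diag_ideal"
  shows "\<exists>k::nat. fst (Z [^]\<^bsub>mctx_ring\<^esub> k) = (\<zero>\<^bsub>A\<^esub>, \<zero>\<^bsub>M\<^esub>)"
proof -
  interpret R: ring mctx_ring by (rule ring_morita_context_ring)
  obtain k where k: "ideal_pow A MN k = {\<zero>\<^bsub>A\<^esub>}"
    using nil by (auto simp: nilpotent_ideal_def)
  have "Z [^]\<^bsub>mctx_ring\<^esub> (2 * i) \<in> row_filtration i i" for i :: nat
  proof (induction i)
    case 0
    show ?case
      using R.one_closed by (auto simp: row_filtration_def morita_context_ring_def \<phi>_closed)
  next
    case (Suc i)
    then show ?case
      using row_filtration_step[OF row_filtration_step[OF Suc Z] Z] by simp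
  qed
  from this[of k] obtain m n b where pow: "Z [^]\<^bsub>mctx_ring\<^esub> (2 * k) = ((\<zero>\<^bsub>A\<^esub>, m), (n, b))"
    and m: "m \<in> carrier M" and mN: "\<And>n'. n' \<in> carrier N \<Longrightarrow> m \<bullet> n' = \<zero>\<^bsub>A\<^esub>"
    by (auto simp: row_filtration_def k morita_context_ring_def)
  obtain p m' n' q where Z_eq: "Z = ((p, m'), (n', q))" and q: "q \<in> NM"
    and c: "p \<in> carrier A" "m' \<in> carrier M" "n' \<in> carrier N"
    using Z ideal.Icarr[OF trace_ideal_is_ideal] by (auto simp: diag_ideal_def)
  have "fst (Z [^]\<^bsub>mctx_ring\<^esub> Suc (2 * k)) = (\<zero>\<^bsub>A\<^esub>, \<zero>\<^bsub>M\<^esub>)"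
    unfolding nat_pow_Suc pow using c mult_NM_eq_zero[OF m mN q] mN
    by (simp add: M_l_zero Z_eq morita_context_ring_def)
  then show ?thesis by blast
qed

lemma row_zero_mult:
  assumes "V \<in> carrier mctx_ring" "Y \<in> carrier mctx_ring" "fst V = (\<zero>\<^bsub>A\<^esub>, \<zero>\<^bsub>M\<^esub>)"
  shows "fst (V \<otimes>\<^bsub>mctx_ring\<^esub> Y) = (\<zero>\<^bsub>A\<^esub>, \<zero>\<^bsub>M\<^esub>)"
proof -
  have "\<zero>\<^bsub>M\<^esub> \<triangleleft>\<^bsub>M\<^esub> b = \<zero>\<^bsub>M\<^esub>" if "b \<in> carrier B" for b
    using M.r_distr[of b "\<zero>\<^bsub>M\<^esub>" "\<zero>\<^bsub>M\<^esub>"] that by (simp add: M.r_closed)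
  then show ?thesis
    using assms by (auto simp: morita_context_ring_def \<phi>_zero_left M_l_zero)
qed

text \<open>A power of \<open>Z\<close> has zero first row, a power of the swapped matrix has zero first row, and zero
  first rows persist under right multiplication; hence a common power of \<open>Z\<close> vanishes.\<close>

lemma nilpotent_if_mem_diag_ideal:
  assumes MN: "nilpotent_ideal MN A" and NM: "nilpotent_ideal NM B" and Z: "Z \<in> diag_ideal"
  shows "nilpotent mctx_ring Z"
proof -
  interpret R: ring mctx_ring by (rule ring_morita_context_ring)
  interpret S: morita_context B A N M \<psi> \<phi> by (rule swap)
  let ?\<sigma> = "\<lambda>((a, m), (n, b)). ((b, n), (m, a))"
  interpret \<sigma>: ring_hom_ring mctx_ring S.mctx_ring ?\<sigma>
    by (rule ring_hom_morita_swap) (rule morita_context_axioms)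
  have Zc: "Z \<in> carrier mctx_ring" using Z diag_ideal_subset by blast
  obtain k :: nat where k: "fst (Z [^]\<^bsub>mctx_ring\<^esub> k) = (\<zero>\<^bsub>A\<^esub>, \<zero>\<^bsub>M\<^esub>)"
    using first_row_pow_eq_zero[OF MN Z] by blast
  have "?\<sigma> Z \<in> S.diag_ideal" using Z by (auto simp: diag_ideal_def S.diag_ideal_def)
  then obtain l :: nat where l: "fst (?\<sigma> Z [^]\<^bsub>S.mctx_ring\<^esub> l) = (\<zero>\<^bsub>B\<^esub>, \<zero>\<^bsub>N\<^esub>)"
    using S.first_row_pow_eq_zero[OF NM] by blast
  have first: "fst (Z [^]\<^bsub>mctx_ring\<^esub> (k + l)) = (\<zero>\<^bsub>A\<^esub>, \<zero>\<^bsub>M\<^esub>)"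
    using row_zero_mult[OF _ _ k, of "Z [^]\<^bsub>mctx_ring\<^esub> l"] Zc by (simp add: R.nat_pow_mult)
  have "fst (?\<sigma> Z [^]\<^bsub>S.mctx_ring\<^esub> (l + k)) = (\<zero>\<^bsub>B\<^esub>, \<zero>\<^bsub>N\<^esub>)"
    using S.row_zero_mult[OF _ _ l, of "?\<sigma> Z [^]\<^bsub>S.mctx_ring\<^esub> k"] \<sigma>.hom_closed[OF Zc]
    by (simp add: \<sigma>.S.nat_pow_mult)
  then have "fst (?\<sigma> (Z [^]\<^bsub>mctx_ring\<^esub> (k + l))) = (\<zero>\<^bsub>B\<^esub>, \<zero>\<^bsub>N\<^esub>)"
    using Zc by (simp add: \<sigma>.hom_nat_pow add.commute)
  then have "Z [^]\<^bsub>mctx_ring\<^esub> (k + l) = \<zero>\<^bsub>mctx_ring\<^esub>"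
    using first by (cases "Z [^]\<^bsub>mctx_ring\<^esub> (k + l)") (auto simp: morita_context_ring_def)
  then show ?thesis by (auto simp: nilpotent_def)
qed

section \<open>Corners and the unit condition\<close>

lemma ring_hom_corner:
  "ring_hom_ring mctx_ring (A Quot MN) (\<lambda>V. MN +>\<^bsub>A\<^esub> fst (fst V))"
proof -
  interpret P: ideal MN A by (rule trace_ideal_is_ideal)
  interpret q: ring_hom_ring A "A Quot MN" "(+>\<^bsub>A\<^esub>) MN" by (rule P.rcos_ring_hom_ring)
  have "MN +>\<^bsub>A\<^esub> (a \<oplus>\<^bsub>A\<^esub> m \<bullet> n) = MN +>\<^bsub>A\<^esub> a"
    if "a \<in> carrier A" "m \<in> carrier M" "n \<in> carrier N" for a m n
    using that P.rcos_eq_zero_iff[of "m \<bullet> n"] mn_mem_MN[of m n] by (simp add: \<phi>_closed)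
  then show ?thesis
    by (intro ring_hom_ringI2 ring_morita_context_ring P.quotient_is_ring ring_hom_memI)
      (auto simp: morita_context_ring_def)
qed

text \<open>The matrix \<open>diag(u, 1)\<close>, rather than \<open>diag(u, 0)\<close>, is a unit. The function \<open>d\<close> of the proof is the
  diagonal embedding of the product of \<open>A\<close> and \<open>B\<close>.\<close>

lemma n_UU_corner:
  assumes "n_UU k mctx_ring"
  shows "n_UU k A"
  unfolding n_UU_def
proof
  interpret R: ring mctx_ring by (rule ring_morita_context_ring)
  define d where "d = (\<lambda>a b. ((a, \<zero>\<^bsub>M\<^esub>), (\<zero>\<^bsub>N\<^esub>, b)) :: ('a \<times> 'm) \<times> ('n \<times> 'b))"
  have zeros: "a \<odot>\<^bsub>M\<^esub> \<zero>\<^bsub>M\<^esub> = \<zero>\<^bsub>M\<^esub>" "\<zero>\<^bsub>M\<^esub> \<triangleleft>\<^bsub>M\<^esub> b = \<zero>\<^bsub>M\<^esub>" "b \<odot>\<^bsub>N\<^esub> \<zero>\<^bsub>N\<^esub> = \<zero>\<^bsub>N\<^esub>" "\<zero>\<^bsub>N\<^esub> \<triangleleft>\<^bsub>N\<^esub> a = \<zero>\<^bsub>N\<^esub>"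
    if "a \<in> carrier A" "b \<in> carrier B" for a b
    using that M.l_distr[of a "\<zero>\<^bsub>M\<^esub>" "\<zero>\<^bsub>M\<^esub>"] M.r_distr[of b "\<zero>\<^bsub>M\<^esub>" "\<zero>\<^bsub>M\<^esub>"]
      N.l_distr[of b "\<zero>\<^bsub>N\<^esub>" "\<zero>\<^bsub>N\<^esub>"] N.r_distr[of a "\<zero>\<^bsub>N\<^esub>" "\<zero>\<^bsub>N\<^esub>"]
    by (simp_all add: M.l_closed M.r_closed N.l_closed N.r_closed)
  have d_closed: "d a b \<in> carrier mctx_ring" if "a \<in> carrier A" "b \<in> carrier B" for a b
    using that by (simp add: d_def morita_context_ring_def)
  have d_mult: "d a b \<otimes>\<^bsub>mctx_ring\<^esub> d a' b' = d (a \<otimes>\<^bsub>A\<^esub> a') (b \<otimes>\<^bsub>B\<^esub> b')"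
    if "a \<in> carrier A" "b \<in> carrier B" "a' \<in> carrier A" "b' \<in> carrier B" for a b a' b'
    using that by (simp add: d_def morita_context_ring_def zeros \<phi>_zero_left
        morita_context.\<phi>_zero_left[OF swap])
  have d_one: "\<one>\<^bsub>mctx_ring\<^esub> = d \<one>\<^bsub>A\<^esub> \<one>\<^bsub>B\<^esub>" by (simp add: d_def morita_context_ring_def)
  have d_pow: "d a b [^]\<^bsub>mctx_ring\<^esub> i = d (a [^]\<^bsub>A\<^esub> i) (b [^]\<^bsub>B\<^esub> i)"
    if "a \<in> carrier A" "b \<in> carrier B" for a b and i :: nat
    by (induction i) (simp_all add: d_one d_mult that)
  have d_minus: "d a b \<ominus>\<^bsub>mctx_ring\<^esub> d a' b' = d (a \<ominus>\<^bsub>A\<^esub> a') (b \<ominus>\<^bsub>B\<^esub> b')"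
    if "a \<in> carrier A" "b \<in> carrier B" "a' \<in> carrier A" "b' \<in> carrier B" for a b a' b'
  proof -
    have "d (a \<ominus>\<^bsub>A\<^esub> a') (b \<ominus>\<^bsub>B\<^esub> b') \<oplus>\<^bsub>mctx_ring\<^esub> d a' b' = d a b"
      using that by (simp add: d_def morita_context_ring_def A.minus_eq B.minus_eq A.a_assoc B.a_assoc A.l_neg B.l_neg)
    then show ?thesis
      using that by (metis R.add.inv_solve_right R.minus_eq A.minus_closed B.minus_closed d_closed)
  qed
  fix u assume u: "u \<in> Units A"
  then have uc: "u \<in> carrier A" "inv\<^bsub>A\<^esub> u \<in> carrier A" by (simp_all add: A.Units_closed)
  have "d u \<one>\<^bsub>B\<^esub> \<in> Units mctx_ring"
    using u uc unfolding Units_def[of mctx_ring]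
    by (auto simp: d_closed d_mult d_one intro!: bexI[of _ "d (inv\<^bsub>A\<^esub> u) \<one>\<^bsub>B\<^esub>"])
  then have "nilpotent mctx_ring (d u \<one>\<^bsub>B\<^esub> [^]\<^bsub>mctx_ring\<^esub> k \<ominus>\<^bsub>mctx_ring\<^esub> \<one>\<^bsub>mctx_ring\<^esub>)"
    using assms by (simp add: n_UU_def)
  then have "nilpotent mctx_ring (d (u [^]\<^bsub>A\<^esub> k \<ominus>\<^bsub>A\<^esub> \<one>\<^bsub>A\<^esub>) (\<one>\<^bsub>B\<^esub> \<ominus>\<^bsub>B\<^esub> \<one>\<^bsub>B\<^esub>))"
    using uc by (simp add: d_one d_pow d_minus)
  then obtain i :: nat where
    "d ((u [^]\<^bsub>A\<^esub> k \<ominus>\<^bsub>A\<^esub> \<one>\<^bsub>A\<^esub>) [^]\<^bsub>A\<^esub> i) ((\<one>\<^bsub>B\<^esub> \<ominus>\<^bsub>B\<^esub> \<one>\<^bsub>B\<^esub>) [^]\<^bsub>B\<^esub> i) = \<zero>\<^bsub>mctx_ring\<^esub>"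
    using uc by (auto simp: nilpotent_def d_pow)
  then show "nilpotent A (u [^]\<^bsub>A\<^esub> k \<ominus>\<^bsub>A\<^esub> \<one>\<^bsub>A\<^esub>)"
    by (auto simp: nilpotent_def d_def morita_context_ring_def)
qed

end

lemma ring_hom_ring_comp:
  assumes "ring_hom_ring R S f" and "ring_hom_ring S T g"
  shows "ring_hom_ring R T (g \<circ> f)"
  using assms ring_hom_trans[of f R S g T]
  by (simp add: ring_hom_ring_def ring_hom_ring_axioms_def)

lemma n_UU_morita_swap:
  assumes "morita_context A B M N \<phi> \<psi>" and "n_UU k (morita_context_ring A B M N \<phi> \<psi>)"
  shows "n_UU k (morita_context_ring B A N M \<psi> \<phi>)"
proof -
  interpret \<sigma>: ring_hom_ring "morita_context_ring A B M N \<phi> \<psi>" "morita_context_ring B A N M \<psi> \<phi>"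
    "\<lambda>((a, m), (n, b)). ((b, n), (m, a))"
    by (rule ring_hom_morita_swap) fact
  show ?thesis
  proof (rule \<sigma>.n_UU_image[OF _ _ assms(2)])
    show "(\<lambda>((a, m), (n, b)). ((b, n), (m, a))) ` carrier (morita_context_ring A B M N \<phi> \<psi>)
        = carrier (morita_context_ring B A N M \<psi> \<phi>)"
      by (force simp: morita_context_ring_def)
    show "nilpotent (morita_context_ring A B M N \<phi> \<psi>) V"
      if "V \<in> carrier (morita_context_ring A B M N \<phi> \<psi>)"
        "(\<lambda>((a, m), (n, b)). ((b, n), (m, a))) V = \<zero>\<^bsub>morita_context_ring B A N M \<psi> \<phi>\<^esub>" for V
    proof -
      have "V = \<zero>\<^bsub>morita_context_ring A B M N \<phi> \<psi>\<^esub>"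
        using that(2) by (auto simp: morita_context_ring_def split: prod.splits)
      then have "V [^]\<^bsub>morita_context_ring A B M N \<phi> \<psi>\<^esub> (1::nat) = \<zero>\<^bsub>morita_context_ring A B M N \<phi> \<psi>\<^esub>"
        using that(1) by simp
      then show ?thesis unfolding nilpotent_def by (rule exI)
    qed
  qed
qed

theorem theorem2p31:
  fixes n :: nat
    and A :: "('a, 'x) ring_scheme" and B :: "('b, 'y) ring_scheme"
    and M :: "('a, 'b, 'm) bimodule" and N :: "('b, 'a, 'n) bimodule"
    and \<phi> :: "('m \<times> 'n \<Rightarrow>\<^sub>0 int) set \<Rightarrow> 'a" and \<psi> :: "('n \<times> 'm \<Rightarrow>\<^sub>0 int) set \<Rightarrow> 'b"
  assumes "n > 0"
    and "odd n \<or> (\<exists>k::nat. k > 0 \<and> n = 2 ^ k) \<or> n = 6 \<or> n = 10"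
    and "morita_context A B M N \<phi> \<psi>"
    and "nilpotent_ideal (trace_ideal B M N \<phi>) A"
    and "nilpotent_ideal (trace_ideal A N M \<psi>) B"
  shows "n_UU n (morita_context_ring A B M N \<phi> \<psi>) \<longleftrightarrow> n_UU n A \<and> n_UU n B"
proof -
  interpret morita_context A B M N \<phi> \<psi> by fact
  interpret S: morita_context B A N M \<psi> \<phi> by (rule swap)
  interpret P: ideal MN A by (rule trace_ideal_is_ideal)
  interpret Q: ideal NM B by (rule S.trace_ideal_is_ideal)
  show ?thesis
  proof
    assume R: "n_UU n mctx_ring"
    show "n_UU n A \<and> n_UU n B"
      using n_UU_corner[OF R] S.n_UU_corner[OF n_UU_morita_swap[OF assms(3) R]] ..
  next
    assume AB: "n_UU n A \<and> n_UU n B"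
    let ?\<sigma> = "\<lambda>((a, m), (n, b)). ((b, n), (m, a))"
    show "n_UU n mctx_ring"
    proof (rule n_UU_if_joint_kernel_nil[OF ring_hom_corner
          ring_hom_ring_comp[OF ring_hom_morita_swap[OF assms(3)] S.ring_hom_corner]])
      show "n_UU n (A Quot MN)" "n_UU n (B Quot NM)"
        using AB n_UU_quotient_nilpotent_ideal assms(4,5) by blast+
    next
      fix V assume V: "V \<in> carrier mctx_ring" "MN +>\<^bsub>A\<^esub> fst (fst V) = \<zero>\<^bsub>A Quot MN\<^esub>"
        "((\<lambda>V. NM +>\<^bsub>B\<^esub> fst (fst V)) \<circ> ?\<sigma>) V = \<zero>\<^bsub>B Quot NM\<^esub>"
      then have "V \<in> diag_ideal"
        by (auto simp: morita_context_ring_def diag_ideal_def P.rcos_eq_zero_iff Q.rcos_eq_zero_iff)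
      then show "nilpotent mctx_ring V"
        by (rule nilpotent_if_mem_diag_ideal[OF assms(4,5)])
    qed
  qed
qed

end
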